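(* Let $\Gamma$ be a finite chordal graph and let $X$ be a bounded degree graph that is not coarsely separable by a family $\mathcal{S}$ of subspaces of growth $V_{\mathcal{S}}(r)=O\left(r^{\mathrm{clique}(\Gamma)}\right)$ (e.g. $X\in\mathfrak{M}_d$ for some $d>\mathrm{clique}(\Gamma)$). Then there does not exist any coarse embedding of $X$ into the right-angled Artin group $A(\Gamma)$.
   Context: A graph is chordal if it has no induced cycle of length $\geq 4$; $\mathrm{clique}(\Gamma)$ is the maximal number of vertices of a complete subgraph of $\Gamma$. $A(\Gamma)$ is the group generated by the vertices of $\Gamma$ subject to the relations that adjacent vertices commute, with a word metric. A coarse embedding $\rho:X\to Y$ is a map for which there are non-decreasing functions $\rho_\pm:[0,\infty)\to[0,\infty)$ with $\rho_-(t)\to\infty$ as $t\to\infty$ and $\rho_-(d(x,y))\leq d(\rho(x),\rho(y))\leq\rho_+(d(x,y))$ for all $x,y$. The graph $X$ is understood to be connected and is identified with its vertex set with the path metric. For $C\subset X$ and $R\geq0$, $C^{+R}=\{x\in X : d(x,C)\leq R\}$. A $k$-path is a finite sequence of points whose consecutive points are at distance $\leq k$; a subset is $k$-coarsely connected if any two of its points are joined by a $k$-path contained in it; the $k$-coarsely connected components of a subset are its maximal $k$-coarsely connected subsets. A collection $\mathcal{S}$ of subsets of $X$ coarsely separates $X$ if there exist $k,L\geq 0$ such that $X$ is $k$-coarsely connected and, for every $D\geq 0$, there is some $S\in\mathcal{S}$ such that $X\setminus S^{+L}$ has at least two $k$-coarsely connected components containing points at distance $\geq D$ from $S$. The growth of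 $\mathcal{S}$ is $V_{\mathcal{S}}(r)=\sup\{|B_X(s,r)\cap S| : s\in S,\ S\in\mathcal{S}\}$, where $B_X(s,r)$ is the ball of radius $r$ centred at $s$. $f\gtrsim g$ means that there is $C>0$ with $f(t)\geq Cg(Ct+C)+C$ for all $t\geq0$. For $d>0$, $\mathfrak{M}_d$ is the class of metric spaces quasi-isometric to a bounded degree graph in which every coarsely separating family $\mathcal{S}$ has growth at least $r^d$, i.e. satisfies $V_{\mathcal{S}}(r)\gtrsim r^d$.
   Formalization: X is assumed infinite: a finite connected X is never coarsely separable yet embeds coarsely by a constant map, so the claim fails there. In the definition of 𝔐_d the bounded degree graph has natural numbers as vertices, which is no loss since such connected graphs are countable. *)

theory Defs
  imports
    "HOL-Analysis.Analysis"
    "HOL-Algebra.Generated_Groups"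
    "Graph_Theory.Graph_Theory"
begin

section \<open>Graphs\<close>

text \<open>
  Simple graphs are symmetric loop-free digraphs whose arcs are ordered pairs of vertices:
  \<^locale>\<open>pair_bidirected_digraph\<close> for possibly infinite graphs, \<^locale>\<open>pair_graph\<close> for
  finite ones. Each edge is present as two opposite arcs, so the out-degree is the usual degree.
\<close>

definition bounded_degree_graph :: "'a pair_pre_digraph \<Rightarrow> bool" where
  "bounded_degree_graph X \<longleftrightarrow>
     pair_bidirected_digraph X \<and>
     Digraph_Component.connected (with_proj X) \<and>
     (\<exists>N. \<forall>v\<in>pverts X. finite (out_arcs (with_proj X) v) \<and> out_degree (with_proj X) v \<le> N)"

definition graph_dist :: "'a pair_pre_digraph \<Rightarrow> 'a \<Rightarrow> 'a \<Rightarrow> real" where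
  "graph_dist X u v = real_of_ereal (wf_digraph.\<mu> (with_proj X) (\<lambda>_. 1) u v)"

definition induced_cycle :: "'a pair_pre_digraph \<Rightarrow> 'a list \<Rightarrow> bool" where
  "induced_cycle G vs \<longleftrightarrow>
     3 \<le> length vs \<and> distinct vs \<and> set vs \<subseteq> pverts G \<and>
     (\<forall>i<length vs. \<forall>j<length vs.
        (vs ! i, vs ! j) \<in> parcs G \<longleftrightarrow>
          j = Suc i mod length vs \<or> i = Suc j mod length vs)"

definition chordal :: "'a pair_pre_digraph \<Rightarrow> bool" where
  "chordal G \<longleftrightarrow> \<not> (\<exists>vs. induced_cycle G vs \<and> 4 \<le> length vs)"

definition clique_number :: "'a pair_pre_digraph \<Rightarrow> nat" where
  "clique_number G =
     Max {card K |K. K \<subseteq> pverts G \<and> (\<forall>u\<in>K. \<forall>v\<in>K. u \<noteq> v \<longrightarrow> (u, v) \<in> parcs G)}"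


section \<open>Right-angled Artin groups\<close>

text \<open>
  The letter \<^term>\<open>(a, True)\<close> stands for the generator \<^term>\<open>a\<close> and \<^term>\<open>(a, False)\<close> for its
  inverse. The group with generators \<^term>\<open>V\<close> and relators \<^term>\<open>R\<close> is the set of words
  modulo the least congruence that cancels inverse pairs and kills every relator.
\<close>

inductive presentation_eq ::
    "'v set \<Rightarrow> ('v \<times> bool) list set \<Rightarrow> ('v \<times> bool) list \<Rightarrow> ('v \<times> bool) list \<Rightarrow> bool"
  for V :: "'v set" and R :: "('v \<times> bool) list set" where
    refl: "w \<in> lists (V \<times> UNIV) \<Longrightarrow> presentation_eq V R w w"
  | sym: "presentation_eq V R u w \<Longrightarrow> presentation_eq V R w u"
  | trans: "presentation_eq V R u v \<Longrightarrow> presentation_eq V R v w \<Longrightarrow> presentation_eq V R u w"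
  | append: "presentation_eq V R u v \<Longrightarrow> presentation_eq V R u' v' \<Longrightarrow>
      presentation_eq V R (u @ u') (v @ v')"
  | cancel: "a \<in> V \<Longrightarrow> presentation_eq V R [(a, b), (a, \<not> b)] []"
  | relator: "r \<in> R \<Longrightarrow> r \<in> lists (V \<times> UNIV) \<Longrightarrow> presentation_eq V R r []"

definition presentation_rel ::
    "'v set \<Rightarrow> ('v \<times> bool) list set \<Rightarrow> (('v \<times> bool) list \<times> ('v \<times> bool) list) set" where
  "presentation_rel V R = {(u, w). presentation_eq V R u w}"

definition presented_group ::
    "'v set \<Rightarrow> ('v \<times> bool) list set \<Rightarrow> ('v \<times> bool) list set monoid" where
  "presented_group V R =
     \<lparr> carrier = lists (V \<times> UNIV) // presentation_rel V R,
       mult = (\<lambda>A B. \<Union>a\<in>A. \<Union>b\<in>B. presentation_rel V R `` {a @ b}),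
       one = presentation_rel V R `` {[]} \<rparr>"

definition raag :: "'v pair_pre_digraph \<Rightarrow> ('v \<times> bool) list set monoid" where
  "raag \<Gamma> = presented_group (pverts \<Gamma>)
     {[(a, True), (b, True), (a, False), (b, False)] |a b. (a, b) \<in> parcs \<Gamma>}"

definition word_length :: "('g, 'b) monoid_scheme \<Rightarrow> 'g set \<Rightarrow> 'g \<Rightarrow> nat" where
  "word_length G T g =
     (LEAST n. \<exists>ws. length ws = n \<and> set ws \<subseteq> T \<union> m_inv G ` T \<and> foldr (mult G) ws \<one>\<^bsub>G\<^esub> = g)"

definition word_dist :: "('g, 'b) monoid_scheme \<Rightarrow> 'g set \<Rightarrow> 'g \<Rightarrow> 'g \<Rightarrow> real" where
  "word_dist G T g h = real (word_length G T (inv\<^bsub>G\<^esub> g \<otimes>\<^bsub>G\<^esub> h))"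


section \<open>Coarse geometry\<close>

text \<open>
  As in \<^locale>\<open>Metric_space\<close>, a metric space is given by a carrier set and a distance
  function.
\<close>

definition coarse_embedding ::
    "'a set \<Rightarrow> ('a \<Rightarrow> 'a \<Rightarrow> real) \<Rightarrow> 'b set \<Rightarrow> ('b \<Rightarrow> 'b \<Rightarrow> real) \<Rightarrow> ('a \<Rightarrow> 'b) \<Rightarrow> bool" where
  "coarse_embedding M d M' d' f \<longleftrightarrow>
     f ` M \<subseteq> M' \<and>
     (\<exists>\<rho>1 \<rho>2 :: real \<Rightarrow> real.
        \<rho>1 ` {0..} \<subseteq> {0..} \<and> mono_on {0..} \<rho>1 \<and>
        \<rho>2 ` {0..} \<subseteq> {0..} \<and> mono_on {0..} \<rho>2 \<and>
        filterlim \<rho>1 at_top at_top \<and>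
        (\<forall>x\<in>M. \<forall>y\<in>M. \<rho>1 (d x y) \<le> d' (f x) (f y) \<and> d' (f x) (f y) \<le> \<rho>2 (d x y)))"

definition quasi_isometric ::
    "'a set \<Rightarrow> ('a \<Rightarrow> 'a \<Rightarrow> real) \<Rightarrow> 'b set \<Rightarrow> ('b \<Rightarrow> 'b \<Rightarrow> real) \<Rightarrow> bool" where
  "quasi_isometric M d M' d' \<longleftrightarrow>
     (\<exists>f. f ` M \<subseteq> M' \<and> (\<exists>K\<ge>1. \<exists>C\<ge>0.
        (\<forall>x\<in>M. \<forall>y\<in>M. d x y / K - C \<le> d' (f x) (f y) \<and> d' (f x) (f y) \<le> K * d x y + C) \<and>
        (\<forall>z\<in>M'. \<exists>x\<in>M. d' z (f x) \<le> C)))"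

text \<open>Extended-real valued, so that the distance to the empty set is infinite.\<close>

definition dist_to_set :: "('a \<Rightarrow> 'a \<Rightarrow> real) \<Rightarrow> 'a \<Rightarrow> 'a set \<Rightarrow> ereal" where
  "dist_to_set d x C = (INF c\<in>C. ereal (d x c))"

definition neighbourhood ::
    "'a set \<Rightarrow> ('a \<Rightarrow> 'a \<Rightarrow> real) \<Rightarrow> 'a set \<Rightarrow> real \<Rightarrow> 'a set" where
  "neighbourhood M d C R = {x\<in>M. dist_to_set d x C \<le> ereal R}"

definition coarsely_connected :: "('a \<Rightarrow> 'a \<Rightarrow> real) \<Rightarrow> real \<Rightarrow> 'a set \<Rightarrow> bool" where
  "coarsely_connected d k A \<longleftrightarrow>
     (\<forall>x\<in>A. \<forall>y\<in>A. \<exists>p. p \<noteq> [] \<and> hd p = x \<and> last p = y \<and> set p \<subseteq> A \<and>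
        successively (\<lambda>u v. d u v \<le> k) p)"

definition coarse_components :: "('a \<Rightarrow> 'a \<Rightarrow> real) \<Rightarrow> real \<Rightarrow> 'a set \<Rightarrow> 'a set set" where
  "coarse_components d k A =
     {C. C \<subseteq> A \<and> coarsely_connected d k C \<and>
         (\<forall>C'. C \<subseteq> C' \<and> C' \<subseteq> A \<and> coarsely_connected d k C' \<longrightarrow> C' = C)}"

definition coarsely_separates ::
    "'a set \<Rightarrow> ('a \<Rightarrow> 'a \<Rightarrow> real) \<Rightarrow> 'a set set \<Rightarrow> bool" where
  "coarsely_separates M d \<S> \<longleftrightarrow>
     (\<forall>S\<in>\<S>. S \<subseteq> M) \<and>
     (\<exists>k\<ge>0. \<exists>L\<ge>0. coarsely_connected d k M \<and>
        (\<forall>D\<ge>0. \<exists>S\<in>\<S>.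
           \<exists>A \<in> coarse_components d k (M - neighbourhood M d S L).
           \<exists>B \<in> coarse_components d k (M - neighbourhood M d S L).
             A \<noteq> B \<and>
             (\<exists>x\<in>A. dist_to_set d x S \<ge> ereal D) \<and> (\<exists>x\<in>B. dist_to_set d x S \<ge> ereal D)))"

text \<open>
  The growth of a family, with values in \<^typ>\<open>ennreal\<close>: the counting measure gives infinite sets
  the value \<open>\<infinity>\<close>, unbounded suprema are \<open>\<infinity>\<close>, and the growth of a family
  without points is \<open>0\<close>. Balls are closed.
\<close>

definition growth ::
    "'a set \<Rightarrow> ('a \<Rightarrow> 'a \<Rightarrow> real) \<Rightarrow> 'a set set \<Rightarrow> real \<Rightarrow> ennreal" where
  "growth M d \<S> r =
     (SUP S\<in>\<S>. SUP s\<in>S. emeasure (count_space UNIV) (Metric_space.mcball M d s r \<inter> S))"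

definition growth_bigo :: "(real \<Rightarrow> ennreal) \<Rightarrow> (real \<Rightarrow> real) \<Rightarrow> bool" where
  "growth_bigo V g \<longleftrightarrow> (\<exists>C>0. \<forall>\<^sub>F r in at_top. V r \<le> ennreal (C * g r))"

definition growth_at_least :: "(real \<Rightarrow> ennreal) \<Rightarrow> (real \<Rightarrow> real) \<Rightarrow> bool" where
  "growth_at_least V g \<longleftrightarrow> (\<exists>C>0. \<forall>t\<ge>0. V t \<ge> ennreal (C * g (C * t + C) + C))"

text \<open>
  The class \<open>\<frak>M\<^sub>d\<close>. A connected graph of bounded degree has countably many vertices, so
  it is no restriction that the vertices of \<^term>\<open>Y\<close> are natural numbers.
\<close>

definition class_M :: "real \<Rightarrow> 'a set \<Rightarrow> ('a \<Rightarrow> 'a \<Rightarrow> real) \<Rightarrow> bool" where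
  "class_M d M dist_M \<longleftrightarrow>
     Metric_space M dist_M \<and>
     (\<exists>Y :: nat pair_pre_digraph.
        bounded_degree_graph Y \<and>
        quasi_isometric M dist_M (pverts Y) (graph_dist Y) \<and>
        (\<forall>\<S>. coarsely_separates (pverts Y) (graph_dist Y) \<S> \<longrightarrow>
           growth_at_least (growth (pverts Y) (graph_dist Y) \<S>) (\<lambda>r. r powr d)))"


section \<open>Basic properties\<close>

lemma presentation_eq_words:
  "presentation_eq V R u w \<Longrightarrow> u \<in> lists (V \<times> UNIV) \<and> w \<in> lists (V \<times> UNIV)"
  by (induction rule: presentation_eq.induct) auto

lemma equiv_presentation_rel: "equiv (lists (V \<times> UNIV)) (presentation_rel V R)"
  unfolding presentation_rel_def
  by (rule equivI) (auto simp: refl_on_def sym_def trans_def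
      intro: presentation_eq.intros dest: presentation_eq_words)

lemma presented_mult:
  assumes "u \<in> lists (V \<times> UNIV)" "w \<in> lists (V \<times> UNIV)"
  shows "(presentation_rel V R `` {u}) \<otimes>\<^bsub>presented_group V R\<^esub> (presentation_rel V R `` {w})
    = presentation_rel V R `` {u @ w}"
proof -
  have "congruent2 (presentation_rel V R) (presentation_rel V R)
     (\<lambda>a b. presentation_rel V R `` {a @ b})"
  proof (unfold congruent2_def, clarify)
    fix a b a' b'
    assume "(a, b) \<in> presentation_rel V R" "(a', b') \<in> presentation_rel V R"
    then have "(a @ a', b @ b') \<in> presentation_rel V R"
      unfolding presentation_rel_def by (auto intro: presentation_eq.append)
    then show "presentation_rel V R `` {a @ a'} = presentation_rel V R `` {b @ b'}"
      by (rule equiv_class_eq[OF equiv_presentation_rel])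
  qed
  from UN_equiv_class2[OF equiv_presentation_rel equiv_presentation_rel this assms]
  show ?thesis by (simp add: presented_group_def)
qed

lemma presented_inv:
  assumes "w \<in> lists (V \<times> UNIV)"
  shows "presentation_eq V R (rev (map (\<lambda>(a, b). (a, \<not> b)) w) @ w) []"
  using assms
proof (induction w)
  case Nil
  then show ?case by (auto intro: presentation_eq.refl)
next
  case (Cons x w)
  obtain a b where x: "x = (a, b)" by force
  let ?i = "rev (map (\<lambda>(a, b). (a, \<not> b)) w)"
  have "?i \<in> lists (V \<times> UNIV)" "w \<in> lists (V \<times> UNIV)" using Cons.hyps Cons.prems by (auto simp: in_lists_conv_set)
  moreover have "presentation_eq V R [(a, \<not> b), (a, \<not> \<not> b)] []"
    using Cons.hyps Cons.prems x by (intro presentation_eq.cancel) auto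
  ultimately have "presentation_eq V R (?i @ ([(a, \<not> b), (a, b)] @ w)) (?i @ ([] @ w))"
    by (intro presentation_eq.append presentation_eq.refl) auto
  with Cons show ?case by (auto simp: x intro: presentation_eq.trans)
qed

lemma group_presented_group: "group (presented_group V R)"
proof (rule groupI)
  let ?G = "presented_group V R" and ?r = "presentation_rel V R" and ?W = "lists (V \<times> (UNIV :: bool set))"
  have car: "carrier ?G = ?W // ?r" and one: "\<one>\<^bsub>?G\<^esub> = ?r `` {[]}"
    by (simp_all add: presented_group_def)
  have E: "\<exists>w\<in>?W. x = ?r `` {w}" if "x \<in> carrier ?G" for x
    using that unfolding car by (auto elim: quotientE)
  have I: "?r `` {w} \<in> carrier ?G" if "w \<in> ?W" for w
    using that unfolding car by (rule quotientI)
  show "\<one>\<^bsub>?G\<^esub> \<in> carrier ?G" unfolding one by (rule I) simp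
  fix x assume x: "x \<in> carrier ?G"
  then obtain u where u: "u \<in> ?W" "x = ?r `` {u}" using E by blast
  show "\<one>\<^bsub>?G\<^esub> \<otimes>\<^bsub>?G\<^esub> x = x" unfolding one using presented_mult[of "[]" V u R] u by simp
  let ?v = "rev (map (\<lambda>(a, b). (a, \<not> b)) u)"
  have v: "?v \<in> ?W" using u by (auto simp: in_lists_conv_set)
  show "\<exists>y\<in>carrier ?G. y \<otimes>\<^bsub>?G\<^esub> x = \<one>\<^bsub>?G\<^esub>"
  proof
    show "?r `` {?v} \<in> carrier ?G" using I v .
    have "?r `` {?v @ u} = ?r `` {[]}"
      by (rule equiv_class_eq[OF equiv_presentation_rel]) (simp add: presentation_rel_def presented_inv u)
    then show "?r `` {?v} \<otimes>\<^bsub>?G\<^esub> x = \<one>\<^bsub>?G\<^esub>"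
      unfolding one using presented_mult[OF v u(1)] u by simp
  qed
  fix y assume y: "y \<in> carrier ?G"
  then obtain w where w: "w \<in> ?W" "y = ?r `` {w}" using E by blast
  show "x \<otimes>\<^bsub>?G\<^esub> y \<in> carrier ?G" using I[of "u @ w"] u w by (simp add: presented_mult)
  fix z assume z: "z \<in> carrier ?G"
  then obtain t where t: "t \<in> ?W" "z = ?r `` {t}" using E by blast
  show "x \<otimes>\<^bsub>?G\<^esub> y \<otimes>\<^bsub>?G\<^esub> z = x \<otimes>\<^bsub>?G\<^esub> (y \<otimes>\<^bsub>?G\<^esub> z)"
    using u w t by (simp add: presented_mult)
qed

text \<open>
  A finite connected graph is not coarsely separated by any family, and it coarsely embeds into every
  nonempty space. Non-embedding results for graphs without separating families are
  therefore about infinite graphs.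
\<close>

lemma not_coarsely_separates_finite:
  assumes "finite M"
  shows "\<not> coarsely_separates M d \<S>"
proof
  assume "coarsely_separates M d \<S>"
  then obtain k L where sub: "\<forall>S\<in>\<S>. S \<subseteq> M" and cc: "coarsely_connected d k M"
    and sep: "\<forall>D\<ge>0. \<exists>S\<in>\<S>.
           \<exists>A \<in> coarse_components d k (M - neighbourhood M d S L).
           \<exists>B \<in> coarse_components d k (M - neighbourhood M d S L).
             A \<noteq> B \<and>
             (\<exists>x\<in>A. dist_to_set d x S \<ge> ereal D) \<and> (\<exists>x\<in>B. dist_to_set d x S \<ge> ereal D)"
    unfolding coarsely_separates_def by blast
  define D where "D = (\<Sum>p\<in>M \<times> M. \<bar>d (fst p) (snd p)\<bar>) + 1"
  have D: "d x y < D" if "x \<in> M" "y \<in> M" for x y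
  proof -
    have "\<bar>d x y\<bar> \<le> (\<Sum>p\<in>M \<times> M. \<bar>d (fst p) (snd p)\<bar>)"
      using member_le_sum[of "(x,y)" "M \<times> M" "\<lambda>p. \<bar>d (fst p) (snd p)\<bar>"] assms that by auto
    then show ?thesis unfolding D_def by linarith
  qed
  have "0 \<le> D" unfolding D_def by (auto intro!: add_nonneg_nonneg sum_nonneg)
  obtain S where S: "S \<in> \<S>"
    and sepS: "\<exists>A \<in> coarse_components d k (M - neighbourhood M d S L).
           \<exists>B \<in> coarse_components d k (M - neighbourhood M d S L).
             A \<noteq> B \<and>
             (\<exists>x\<in>A. dist_to_set d x S \<ge> ereal D) \<and> (\<exists>x\<in>B. dist_to_set d x S \<ge> ereal D)"
    using bexE[OF sep[rule_format, OF \<open>0 \<le> D\<close>]] by metis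
  from sepS obtain A B where
    A: "A \<in> coarse_components d k (M - neighbourhood M d S L)"
    and B: "B \<in> coarse_components d k (M - neighbourhood M d S L)"
    and AB: "A \<noteq> B" and far: "\<exists>x\<in>A. dist_to_set d x S \<ge> ereal D" by (elim bexE conjE) (rule that, assumption, assumption, assumption, blast)
  from far A obtain x where x: "x \<in> M" "dist_to_set d x S \<ge> ereal D"
    unfolding coarse_components_def by blast
  have "S = {}"
  proof (rule ccontr)
    assume "S \<noteq> {}"
    then obtain s where s: "s \<in> S" by blast
    then have "dist_to_set d x S \<le> ereal (d x s)" unfolding dist_to_set_def by (rule INF_lower)
    with x(2) have "ereal D \<le> ereal (d x s)" by (rule order_trans)
    moreover have "s \<in> M" using s S sub by blast
    ultimately show False using D[of x s] x(1) by simp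
  qed
  then have M: "M - neighbourhood M d S L = M"
    by (simp add: neighbourhood_def dist_to_set_def top_ereal_def)
  have "C = M" if "C \<in> coarse_components d k M" for C
  proof -
    from that have "C \<subseteq> M" "\<And>C'. C \<subseteq> C' \<Longrightarrow> C' \<subseteq> M \<Longrightarrow> coarsely_connected d k C' \<Longrightarrow> C' = C"
      unfolding coarse_components_def by simp_all
    from this(2)[OF this(1) order_refl cc] show ?thesis by simp
  qed
  with A B AB show False unfolding M by metis
qed

lemma (in wf_digraph) graph_mu_nat:
  assumes "u \<rightarrow>\<^sup>* v"
  shows "\<exists>p. awalk u p v \<and> \<mu> (\<lambda>_. 1) u v = ereal (real (length p)) \<and> (\<forall>q. awalk u q v \<longrightarrow> length p \<le> length q)"
proof -
  have c: "awalk_cost (\<lambda>_. 1) p = real (length p)" for p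
    by (induction p) (auto simp: awalk_cost_def)
  have "\<exists>p. awalk u p v" using assms by (simp add: reachable_awalk)
  then obtain p where p: "awalk u p v" "\<forall>q. awalk u q v \<longrightarrow> length p \<le> length q"
    using ex_has_least_nat[of "\<lambda>p. awalk u p v" _ length] by blast
  moreover have "\<mu> (\<lambda>_. 1) u v = ereal (real (length p))"
    unfolding \<mu>_def c using p by (intro antisym INF_lower2[of p] INF_greatest) auto
  ultimately show ?thesis by blast
qed

lemma Metric_space_graph_dist:
  assumes "pair_bidirected_digraph X" "Digraph_Component.connected (with_proj X)"
  shows "Metric_space (pverts X) (graph_dist X)"
proof -
  interpret pair_bidirected_digraph X by fact
  have mu: "graph_dist X u v = real_of_ereal (\<mu> (\<lambda>_. 1) u v)" for u v
    by (simp add: graph_dist_def)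
  have reach: "u \<rightarrow>\<^sup>*\<^bsub>with_proj X\<^esub> v" if "u \<in> pverts X" "v \<in> pverts X" for u v
  proof -
    have "strongly_connected (with_proj X)"
      using assms(2) connected_def symmetric_connected_imp_strongly_connected pair_sym_arcs by blast
    then show ?thesis using that by auto
  qed
  have rev: "\<exists>q. awalk v q u \<and> length q = length p" if "awalk u p v" for u p v
    using that
  proof (induction p arbitrary: u)
    case Nil
    then show ?case by (intro exI[of _ "[]"]) (auto simp: awalk_Nil_iff)
  next
    case (Cons e p)
    then have e: "e \<in> parcs X" "fst e = u" "awalk (snd e) p v" by (auto simp: awalk_Cons_iff)
    with Cons.IH obtain q where q: "awalk v q (snd e)" "length q = length p" by blast
    have "(snd e, u) \<in> parcs X"
      using pair_sym_arcs e unfolding symmetric_def sym_def by (metis prod.collapse with_proj_simps(3))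
    then have "awalk (snd e) [(snd e, u)] u"
      by (auto simp: awalk_Cons_iff awalk_Nil_iff dest: wellformed')
    with q have "awalk v (q @ [(snd e, u)]) u" by (auto intro: awalk_appendI)
    with q show ?case by (intro exI[of _ "q @ [(snd e, u)]"]) simp
  qed
  have L: "\<exists>p. awalk u p v \<and> graph_dist X u v = length p \<and> (\<forall>q. awalk u q v \<longrightarrow> length p \<le> length q)"
    if "u \<in> pverts X" "v \<in> pverts X" for u v
    using graph_mu_nat[OF reach[OF that]] by (auto simp: mu)
  have out: "graph_dist X u v = 0" if "\<not> (u \<in> pverts X \<and> v \<in> pverts X)" for u v
  proof -
    have "\<not> u \<rightarrow>\<^sup>*\<^bsub>with_proj X\<^esub> v" using that by (metis reachable_in_verts(1,2))
    then show ?thesis by (simp add: mu shortest_path_inf)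
  qed
  show ?thesis
  proof
    fix x y
    show "0 \<le> graph_dist X x y" using L out by (metis of_nat_0_le_iff order_refl)
    show "graph_dist X x y = graph_dist X y x"
    proof (cases "x \<in> pverts X \<and> y \<in> pverts X")
      case True
      with L obtain p q where "awalk x p y" "graph_dist X x y = length p" "\<forall>q. awalk x q y \<longrightarrow> length p \<le> length q"
        "awalk y q x" "graph_dist X y x = length q" "\<forall>p. awalk y p x \<longrightarrow> length q \<le> length p" by metis
      with rev show ?thesis by (metis order_antisym)
    qed (use out in metis)
  next
    fix x y assume xy: "x \<in> pverts X" "y \<in> pverts X"
    show "graph_dist X x y = 0 \<longleftrightarrow> x = y"
    proof
      assume "graph_dist X x y = 0"
      with L[OF xy] obtain p where "awalk x p y" "length p = 0" by auto
      then show "x = y" by (auto simp: awalk_Nil_iff)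
    next
      assume "x = y"
      with xy have "awalk x [] y" by (simp add: awalk_Nil_iff)
      with L[OF xy] show "graph_dist X x y = 0" by force
    qed
    fix z assume z: "z \<in> pverts X"
    obtain p where p: "awalk x p y" "graph_dist X x y = length p" using L[OF xy] by blast
    obtain q where q: "awalk y q z" "graph_dist X y z = length q" using L[OF xy(2) z] by blast
    have "awalk x (p @ q) z" using p q by (auto intro: awalk_appendI)
    moreover obtain t where "awalk x t z" "graph_dist X x z = length t" "\<forall>q. awalk x q z \<longrightarrow> length t \<le> length q"
      using L[OF xy(1) z] by blast
    ultimately have "graph_dist X x z \<le> length (p @ q)" by (metis of_nat_le_iff)
    with p q show "graph_dist X x z \<le> graph_dist X x y + graph_dist X y z" by simp
  qed
qed

end

theory Submission
  imports Defs "HOL-Real_Asymp.Real_Asymp"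
begin

text \<open>
  The first part is proved by contradiction. A chordal graph has a simplicial vertex, that is, a
  vertex \<open>v\<close> whose link is a clique (\<open>simplicial_vertex_exists\<close>). The right-angled Artin group is then an
  HNN extension of the group on the remaining vertices, with stable letter \<open>v\<close>, along the free
  abelian group generated by the link. The cosets of this abelian group give walls in the Cayley graph,
  each of which has two sides. Their preimages under a coarse embedding of \<open>X\<close> grow at most like
  \<open>r ^ clique_number \<Gamma>\<close>, since the link is a clique (\<open>wall_trace_family_growth\<close>). If these preimages
  do not separate \<open>X\<close> coarsely, then every wall has a side on which the image of \<open>X\<close> stays uniformly close to
  the wall (\<open>shallow_sides\<close>). Orienting the walls towards their other sides, one finds a coset of the
  group on the remaining vertices towards which all adjacent walls point, and the image of \<open>X\<close> is within
  bounded distance of it (\<open>near_coset\<close>). Hence \<open>X\<close> embeds coarsely into the right-angled Artin group on one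
  vertex less. Induced subgraphs of chordal graphs are chordal, so this can be repeated until the group
  is trivial, which is absurd for an infinite graph of bounded degree.

  The sides of a wall come from a parity: the set of walls that a
  word crosses an odd number of times depends only on the group element, because the defining
  relators cross every wall an even number of times (\<open>crosses_cong\<close>). That a point outside of a coset lies
  beyond a wall adjacent to it follows by choosing a word with the fewest letters \<open>v\<close>
  (\<open>first_wall_crossed\<close>).

  The second part holds because a quasi-isometry maps a coarsely separating family to a
  coarsely separating family of the same order of growth (\<open>coarsely_separates_image\<close>), and
  \<open>r ^ clique_number \<Gamma>\<close> is eventually below every growth of order \<open>d > clique_number \<Gamma>\<close>.
\<close>

section \<open>Coarse components as reachability classes\<close>

text \<open>
  Chains of such steps replace the lists in the definition of coarse connectedness: reachability
  can be composed, reversed and restricted without list surgery.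
\<close>

definition coarse_step :: "('a \<Rightarrow> 'a \<Rightarrow> real) \<Rightarrow> real \<Rightarrow> 'a set \<Rightarrow> 'a \<Rightarrow> 'a \<Rightarrow> bool" where
  "coarse_step d k A u v \<longleftrightarrow> u \<in> A \<and> v \<in> A \<and> d u v \<le> k"

lemma coarse_path_iff_steps:
  "(\<exists>p. p \<noteq> [] \<and> hd p = x \<and> last p = y \<and> set p \<subseteq> A \<and> successively (\<lambda>u v. d u v \<le> k) p)
    \<longleftrightarrow> x \<in> A \<and> (coarse_step d k A)\<^sup>*\<^sup>* x y"
proof
  assume "\<exists>p. p \<noteq> [] \<and> hd p = x \<and> last p = y \<and> set p \<subseteq> A \<and> successively (\<lambda>u v. d u v \<le> k) p"
  then obtain p where "p \<noteq> []" "hd p = x" "last p = y" "set p \<subseteq> A" "successively (\<lambda>u v. d u v \<le> k) p"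
    by blast
  then show "x \<in> A \<and> (coarse_step d k A)\<^sup>*\<^sup>* x y"
  proof (induction p arbitrary: x rule: induct_list012)
    case (3 a b p)
    then have "(coarse_step d k A)\<^sup>*\<^sup>* b y" by auto
    moreover have "coarse_step d k A a b" using 3 by (auto simp: coarse_step_def)
    ultimately show ?case using 3 by (auto intro: converse_rtranclp_into_rtranclp)
  qed auto
next
  assume *: "x \<in> A \<and> (coarse_step d k A)\<^sup>*\<^sup>* x y"
  then have "(coarse_step d k A)\<^sup>*\<^sup>* x y" by blast
  then show "\<exists>p. p \<noteq> [] \<and> hd p = x \<and> last p = y \<and> set p \<subseteq> A \<and> successively (\<lambda>u v. d u v \<le> k) p"
  proof (induction rule: rtranclp_induct)
    case base
    show ?case using * by (intro exI[of _ "[x]"]) auto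
  next
    case (step y z)
    then obtain p where "p \<noteq> []" "hd p = x" "last p = y" "set p \<subseteq> A" "successively (\<lambda>u v. d u v \<le> k) p"
      by blast
    with step show ?case
      by (intro exI[of _ "p @ [z]"]) (auto simp: successively_append_iff coarse_step_def)
  qed
qed

lemma coarsely_connected_iff:
  "coarsely_connected d k A \<longleftrightarrow> (\<forall>x\<in>A. \<forall>y\<in>A. (coarse_step d k A)\<^sup>*\<^sup>* x y)"
  unfolding coarsely_connected_def coarse_path_iff_steps by blast

lemma coarse_step_mono:
  "A \<subseteq> B \<Longrightarrow> k \<le> l \<Longrightarrow> (coarse_step d k A)\<^sup>*\<^sup>* x y \<Longrightarrow> (coarse_step d l B)\<^sup>*\<^sup>* x y"
  by (rule predicate2D[OF rtranclp_mono]) (auto simp: coarse_step_def)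

context Metric_space
begin

lemma coarse_steps_sym:
  assumes "(coarse_step d k A)\<^sup>*\<^sup>* x y"
  shows "(coarse_step d k A)\<^sup>*\<^sup>* y x"
proof -
  have "symp (coarse_step d k A)" by (auto simp: symp_def coarse_step_def commute)
  then show ?thesis using assms by (meson symp_rtranclp sympD)
qed

definition coarse_component :: "real \<Rightarrow> 'a set \<Rightarrow> 'a \<Rightarrow> 'a set" where
  "coarse_component k A x = {y. (coarse_step d k A)\<^sup>*\<^sup>* x y}"

lemma coarse_component_subset:
  assumes "x \<in> A" shows "coarse_component k A x \<subseteq> A"
proof
  fix y assume "y \<in> coarse_component k A x"
  then have "(coarse_step d k A)\<^sup>*\<^sup>* x y" by (simp add: coarse_component_def)
  then show "y \<in> A" using assms by induction (auto simp: coarse_step_def)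
qed

lemma coarse_component_connected:
  assumes "x \<in> A" shows "coarsely_connected d k (coarse_component k A x)"
proof -
  let ?C = "coarse_component k A x"
  have 1: "(coarse_step d k ?C)\<^sup>*\<^sup>* x y" if "(coarse_step d k A)\<^sup>*\<^sup>* x y" for y
    using that
  proof (induction rule: rtranclp_induct)
    case (step y z)
    then have "coarse_step d k ?C y z"
      by (auto simp: coarse_component_def coarse_step_def intro: rtranclp.rtrancl_into_rtrancl)
    with step show ?case by simp
  qed simp
  show ?thesis unfolding coarsely_connected_iff
  proof (intro ballI)
    fix y z assume "y \<in> ?C" "z \<in> ?C"
    then have "(coarse_step d k ?C)\<^sup>*\<^sup>* x y" "(coarse_step d k ?C)\<^sup>*\<^sup>* x z"
      using 1 by (auto simp: coarse_component_def)
    then show "(coarse_step d k ?C)\<^sup>*\<^sup>* y z" using coarse_steps_sym by (meson rtranclp_trans)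
  qed
qed

lemma coarse_component_superset:
  assumes "C \<subseteq> A" "coarsely_connected d k C" "x \<in> C"
  shows "C \<subseteq> coarse_component k A x"
  using assms coarse_step_mono[OF assms(1) order_refl]
  by (auto simp: coarse_component_def coarsely_connected_iff)

text \<open>
  The empty set has to be removed: when \<open>A\<close> is empty, it is a maximal coarsely connected subset.
\<close>

lemma coarse_components_eq:
  "coarse_components d k A - {{}} = coarse_component k A ` A"
proof (intro equalityI subsetI)
  fix C assume "C \<in> coarse_components d k A - {{}}"
  then obtain x where C: "C \<subseteq> A" "coarsely_connected d k C" "x \<in> C"
    "\<And>C'. C \<subseteq> C' \<Longrightarrow> C' \<subseteq> A \<Longrightarrow> coarsely_connected d k C' \<Longrightarrow> C' = C"
    unfolding coarse_components_def by auto
  have "coarse_component k A x = C"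
    using C by (intro C(4) coarse_component_superset coarse_component_connected coarse_component_subset) auto
  with C show "C \<in> coarse_component k A ` A" by blast
next
  fix C assume "C \<in> coarse_component k A ` A"
  then obtain x where x: "x \<in> A" "C = coarse_component k A x" by blast
  have xC: "x \<in> C" unfolding x coarse_component_def by simp
  have "C' = C" if "C \<subseteq> C'" "C' \<subseteq> A" "coarsely_connected d k C'" for C'
    using coarse_component_superset[OF that(2,3), of x] that(1) xC x(2) by auto
  then show "C \<in> coarse_components d k A - {{}}"
    using xC x(1) coarse_component_subset[OF x(1)] coarse_component_connected[OF x(1)]
    unfolding coarse_components_def x(2) by auto
qed

lemma coarse_component_eq_iff:
  assumes "x \<in> A" "y \<in> A"
  shows "coarse_component k A x = coarse_component k A y \<longleftrightarrow> (coarse_step d k A)\<^sup>*\<^sup>* x y"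
proof
  assume "coarse_component k A x = coarse_component k A y"
  then show "(coarse_step d k A)\<^sup>*\<^sup>* x y" by (auto simp: coarse_component_def set_eq_iff)
next
  assume xy: "(coarse_step d k A)\<^sup>*\<^sup>* x y"
  note yx = coarse_steps_sym[OF xy]
  show "coarse_component k A x = coarse_component k A y"
    unfolding coarse_component_def using rtranclp_trans[OF xy] rtranclp_trans[OF yx] by blast
qed

text \<open>
  A separation is witnessed by two deep points that no coarse path joins outside the thickened set.
  In this form neither direction of use has to speak about maximal connected subsets.
\<close>

lemma coarsely_separates_iff:
  "coarsely_separates M d \<S> \<longleftrightarrow> (\<forall>S\<in>\<S>. S \<subseteq> M) \<and>
     (\<exists>k\<ge>0. \<exists>L\<ge>0. coarsely_connected d k M \<and>
       (\<forall>D\<ge>0. \<exists>S\<in>\<S>. \<exists>x \<in> M - neighbourhood M d S L. \<exists>y \<in> M - neighbourhood M d S L.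
          dist_to_set d x S \<ge> ereal D \<and> dist_to_set d y S \<ge> ereal D \<and>
          \<not> (coarse_step d k (M - neighbourhood M d S L))\<^sup>*\<^sup>* x y))"
proof -
  have "(\<exists>A \<in> coarse_components d k N. \<exists>B \<in> coarse_components d k N.
             A \<noteq> B \<and> (\<exists>x\<in>A. P x) \<and> (\<exists>x\<in>B. P x)) \<longleftrightarrow>
    (\<exists>x\<in>N. \<exists>y\<in>N. P x \<and> P y \<and> \<not> (coarse_step d k N)\<^sup>*\<^sup>* x y)" (is "?l \<longleftrightarrow> ?r") for k N and P :: "'a \<Rightarrow> bool"
  proof
    assume ?l
    then obtain A B x y where AB: "A \<in> coarse_components d k N - {{}}" "B \<in> coarse_components d k N - {{}}"
       "A \<noteq> B" "x \<in> A" "P x" "y \<in> B" "P y" by blast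
    then obtain a b where a: "a \<in> N" "A = coarse_component k N a" and b: "b \<in> N" "B = coarse_component k N b"
      unfolding coarse_components_eq by blast
    have N: "x \<in> N" "y \<in> N" using AB a b coarse_component_subset by blast+
    have "A = coarse_component k N x" "B = coarse_component k N y"
      using AB a b N coarse_component_eq_iff by (metis coarse_component_def mem_Collect_eq)+
    with AB N show ?r using coarse_component_eq_iff[OF N] by blast
  next
    assume ?r
    then obtain x y where xy: "x \<in> N" "y \<in> N" "P x" "P y" "\<not> (coarse_step d k N)\<^sup>*\<^sup>* x y" by blast
    then have "coarse_component k N x \<in> coarse_components d k N" "coarse_component k N y \<in> coarse_components d k N"
      using coarse_components_eq[of k N] by blast+
    moreover have "x \<in> coarse_component k N x" "y \<in> coarse_component k N y" by (auto simp: coarse_component_def)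
    ultimately show ?l using xy coarse_component_eq_iff[OF xy(1,2), of k] by blast
  qed
  then show ?thesis unfolding coarsely_separates_def by auto
qed

end

lemma dist_to_set_ge_iff: "ereal D \<le> dist_to_set d x S \<longleftrightarrow> (\<forall>s\<in>S. D \<le> d x s)"
  by (simp add: dist_to_set_def le_INF_iff)

lemma not_in_neighbourhood_imp:
  "x \<in> M - neighbourhood M d S L \<Longrightarrow> s \<in> S \<Longrightarrow> L < d x s"
  by (auto simp: neighbourhood_def dist_to_set_def not_le less_INF_D dest!: less_INF_D)

lemma not_in_neighbourhoodI:
  assumes "x \<in> M" "\<And>s. s \<in> S \<Longrightarrow> L' \<le> d x s" "L < L'"
  shows "x \<in> M - neighbourhood M d S L"
proof -
  have "ereal L' \<le> dist_to_set d x S" using assms by (simp add: dist_to_set_ge_iff)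
  then have "ereal L < dist_to_set d x S" using assms(3) by (meson ereal_less_le less_ereal.simps(1) order_less_le_trans)
  then show ?thesis using assms(1) by (auto simp: neighbourhood_def)
qed

section \<open>Graphs as metric spaces\<close>

text \<open>
  All that is used about a connected graph: distances are integers, and a distance \<open>n\<close> is realised by
  \<open>n\<close> steps of length at most one.
\<close>

locale graph_metric = Metric_space +
  assumes steps: "x \<in> M \<Longrightarrow> y \<in> M \<Longrightarrow> \<exists>n. d x y = real n \<and> (coarse_step d 1 M ^^ n) x y"
begin

lemma dist_le_steps: "(coarse_step d 1 M ^^ n) x y \<Longrightarrow> x \<in> M \<Longrightarrow> y \<in> M \<and> d x y \<le> real n"
proof (induction n arbitrary: y)
  case (Suc n)
  then obtain z where z: "(coarse_step d 1 M ^^ n) x z" "coarse_step d 1 M z y" by (auto elim: relpowp_Suc_E)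
  with Suc have "z \<in> M" "d x z \<le> n" by auto
  with z Suc.prems triangle[of x z y] show ?case by (auto simp: coarse_step_def)
qed auto

text \<open>
  A geodesic from \<open>x\<close> to \<open>y\<close> never gets farther from \<open>x\<close> than \<open>y\<close> is.
\<close>

lemma joined_within_ball:
  assumes "x \<in> M" "y \<in> M" "d x y \<le> R" "1 \<le> k" "\<And>z. z \<in> M \<Longrightarrow> d x z \<le> R \<Longrightarrow> z \<in> A"
  shows "(coarse_step d k A)\<^sup>*\<^sup>* x y"
proof -
  obtain n where n: "d x y = real n" "(coarse_step d 1 M ^^ n) x y" using steps assms by blast
  have "(coarse_step d k A)\<^sup>*\<^sup>* x y" if "(coarse_step d 1 M ^^ m) x y" "real m \<le> R" for m y
    using that
  proof (induction m arbitrary: y)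
    case (Suc m)
    then obtain z where z: "(coarse_step d 1 M ^^ m) x z" "coarse_step d 1 M z y" by (auto elim: relpowp_Suc_E)
    have "z \<in> M" "d x z \<le> m" using dist_le_steps[OF z(1)] assms by auto
    moreover have "y \<in> M" "d x y \<le> Suc m" using dist_le_steps[OF Suc.prems(1)] assms by auto
    ultimately have "coarse_step d k A z y" using z(2) Suc.prems assms(4,5) by (auto simp: coarse_step_def)
    moreover have "(coarse_step d k A)\<^sup>*\<^sup>* x z" using Suc z by auto
    ultimately show ?case by simp
  qed simp
  with n assms show ?thesis by simp
qed

lemma coarsely_connected_graph: "coarsely_connected d 1 M"
  unfolding coarsely_connected_iff by (auto intro: joined_within_ball)

end

locale bounded_graph_metric = graph_metric +
  assumes unit_balls: "\<exists>N. \<forall>x\<in>M. finite {y\<in>M. d x y \<le> 1} \<and> card {y\<in>M. d x y \<le> 1} \<le> N"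
begin

text \<open>
  A ball of radius \<open>n + 1\<close> is covered by the balls of radius \<open>n\<close> around the neighbours of its
  centre, so the bound is uniform in the centre.
\<close>

lemma balls_bounded:
  "\<exists>N. \<forall>x\<in>M. finite {y\<in>M. d x y \<le> R} \<and> card {y\<in>M. d x y \<le> R} \<le> N"
proof -
  obtain N where N: "\<And>x. x \<in> M \<Longrightarrow> finite {y\<in>M. d x y \<le> 1}" "\<And>x. x \<in> M \<Longrightarrow> card {y\<in>M. d x y \<le> 1} \<le> N"
    using unit_balls by blast
  let ?B = "\<lambda>n x. {y. (coarse_step d 1 M ^^ n) x y}"
  have B: "finite (?B n x) \<and> card (?B n x) \<le> N ^ n" if "x \<in> M" for n x
    using that
  proof (induction n arbitrary: x)
    case 0
    have "?B 0 x = {x}" by auto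
    then show ?case by simp
  next
    case (Suc n)
    let ?U = "{y\<in>M. d x y \<le> 1}"
    have eq: "?B (Suc n) x = (\<Union>z\<in>?U. ?B n z)"
    proof (intro equalityI subsetI)
      fix y assume "y \<in> ?B (Suc n) x"
      then obtain z where "coarse_step d 1 M x z" "(coarse_step d 1 M ^^ n) z y"
        by (metis mem_Collect_eq relpowp_Suc_D2)
      then show "y \<in> (\<Union>z\<in>?U. ?B n z)" by (auto simp: coarse_step_def)
    next
      fix y assume "y \<in> (\<Union>z\<in>?U. ?B n z)"
      then obtain z where "coarse_step d 1 M x z" "(coarse_step d 1 M ^^ n) z y"
        using Suc.prems by (auto simp: coarse_step_def)
      then show "y \<in> ?B (Suc n) x" by (metis mem_Collect_eq relpowp_Suc_I2)
    qed
    have "card (?B (Suc n) x) \<le> (\<Sum>z\<in>?U. card (?B n z))"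
      unfolding eq by (rule card_UN_le) (use N Suc.prems in auto)
    also have "\<dots> \<le> (\<Sum>z\<in>?U. N ^ n)" by (rule sum_mono) (use Suc.IH in auto)
    also have "\<dots> \<le> N ^ Suc n" using N(2)[OF Suc.prems] by simp
    finally have "card (?B (Suc n) x) \<le> N ^ Suc n" .
    moreover have "finite (?B (Suc n) x)" unfolding eq using N(1) Suc by auto
    ultimately show ?case by blast
  qed
  define m where "m = nat \<lceil>R\<rceil>"
  have sub: "{y\<in>M. d x y \<le> R} \<subseteq> (\<Union>n\<le>m. ?B n x)" if "x \<in> M" for x
  proof
    fix y assume "y \<in> {y\<in>M. d x y \<le> R}"
    then have y: "y \<in> M" "d x y \<le> R" by auto
    from steps[OF that y(1)] obtain n where n: "d x y = real n" "(coarse_step d 1 M ^^ n) x y" by blast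
    then have "n \<le> m" using y unfolding m_def by linarith
    with n show "y \<in> (\<Union>n\<le>m. ?B n x)" by blast
  qed
  have "finite {y\<in>M. d x y \<le> R} \<and> card {y\<in>M. d x y \<le> R} \<le> (\<Sum>n\<le>m. N ^ n)" if "x \<in> M" for x
  proof -
    have fin: "finite (\<Union>n\<le>m. ?B n x)" using B that by auto
    have "card {y\<in>M. d x y \<le> R} \<le> card (\<Union>n\<le>m. ?B n x)" using sub[OF that] fin by (rule card_mono[rotated])
    also have "\<dots> \<le> (\<Sum>n\<le>m. card (?B n x))" by (rule card_UN_le) simp
    also have "\<dots> \<le> (\<Sum>n\<le>m. N ^ n)" by (rule sum_mono) (use B that in auto)
    finally show ?thesis using sub[OF that] fin finite_subset by blast
  qed
  then show ?thesis by blast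
qed

end

lemma bounded_graph_metric_graph_dist:
  assumes "bounded_degree_graph X"
  shows "bounded_graph_metric (pverts X) (graph_dist X)"
proof -
  have bd: "pair_bidirected_digraph X" and con: "Digraph_Component.connected (with_proj X)"
    and deg: "\<exists>N. \<forall>v\<in>pverts X. finite (out_arcs (with_proj X) v) \<and> out_degree (with_proj X) v \<le> N"
    using assms unfolding bounded_degree_graph_def by auto
  interpret pair_bidirected_digraph X by fact
  interpret Metric_space "pverts X" "graph_dist X" using Metric_space_graph_dist[OF bd con] .
  have shortest: "\<exists>p. awalk u p v \<and> graph_dist X u v = length p \<and> (\<forall>q. awalk u q v \<longrightarrow> length p \<le> length q)"
    if "u \<in> pverts X" "v \<in> pverts X" for u v
  proof -
    have "strongly_connected (with_proj X)"
      using con connected_def symmetric_connected_imp_strongly_connected pair_sym_arcs by blast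
    then have "u \<rightarrow>\<^sup>*\<^bsub>with_proj X\<^esub> v" using that by auto
    from graph_mu_nat[OF this] show ?thesis by (auto simp: graph_dist_def)
  qed
  have arc: "graph_dist X u v \<le> 1" if "(u, v) \<in> parcs X" for u v
  proof -
    have w: "awalk u [(u, v)] v" using that by (auto simp: awalk_Cons_iff awalk_Nil_iff dest: wellformed')
    have uv: "u \<in> pverts X" "v \<in> pverts X" using that by (auto dest: wellformed')
    from shortest[OF uv] obtain p where
      p: "awalk u p v \<and> graph_dist X u v = length p \<and> (\<forall>q. awalk u q v \<longrightarrow> length p \<le> length q)" ..
    with w have "length p \<le> length [(u, v)]" by blast
    with p show ?thesis by simp
  qed
  have walk: "(coarse_step (graph_dist X) 1 (pverts X) ^^ length p) u v" if "awalk u p v" for u p v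
    using that
  proof (induction p arbitrary: u)
    case (Cons e p)
    then have e: "e \<in> parcs X" "fst e = u" "awalk (snd e) p v" by (auto simp: awalk_Cons_iff)
    then have "(u, snd e) \<in> parcs X" by auto
    then have "coarse_step (graph_dist X) 1 (pverts X) u (snd e)"
      using arc[of u "snd e"] by (auto simp: coarse_step_def dest: wellformed')
    with Cons.IH[OF e(3)] show ?case unfolding length_Cons by (rule relpowp_Suc_I2[rotated])
  qed (auto simp: awalk_Nil_iff)
  show ?thesis
  proof
    fix x y assume xy: "x \<in> pverts X" "y \<in> pverts X"
    from shortest[OF xy] obtain p where
      "awalk x p y \<and> graph_dist X x y = length p \<and> (\<forall>q. awalk x q y \<longrightarrow> length p \<le> length q)" ..
    then have p: "awalk x p y" "graph_dist X x y = length p" by simp_all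
    with walk[OF p(1)] show "\<exists>n. graph_dist X x y = real n \<and> (coarse_step (graph_dist X) 1 (pverts X) ^^ n) x y"
      by (intro exI[of _ "length p"] conjI)
  next
    obtain N where N: "\<And>v. v\<in>pverts X \<Longrightarrow> finite (out_arcs (with_proj X) v)" "\<And>v. v\<in>pverts X \<Longrightarrow> out_degree (with_proj X) v \<le> N"
      using deg by blast
    have "finite {y \<in> pverts X. graph_dist X x y \<le> 1} \<and> card {y \<in> pverts X. graph_dist X x y \<le> 1} \<le> N + 1"
      if x: "x \<in> pverts X" for x
    proof -
      have sub: "{y \<in> pverts X. graph_dist X x y \<le> 1} \<subseteq> insert x (snd ` out_arcs (with_proj X) x)"
      proof
        fix y assume "y \<in> {y \<in> pverts X. graph_dist X x y \<le> 1}"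
        then have y: "y \<in> pverts X" "graph_dist X x y \<le> 1" by simp_all
        from shortest[OF x y(1)] obtain p where
          "awalk x p y \<and> graph_dist X x y = length p \<and> (\<forall>q. awalk x q y \<longrightarrow> length p \<le> length q)" ..
        then have p: "awalk x p y" "graph_dist X x y = length p" by simp_all
        with y(2) have "length p \<le> 1" by simp
        then consider "p = []" | e where "p = [e]" by (cases p) simp_all
        then show "y \<in> insert x (snd ` out_arcs (with_proj X) x)"
          using p by cases (auto simp: awalk_Nil_iff awalk_Cons_iff out_arcs_def image_iff)
      qed
      have fin: "finite (insert x (snd ` out_arcs (with_proj X) x))" using N x by auto
      have "card (insert x (snd ` out_arcs (with_proj X) x)) \<le> Suc (card (snd ` out_arcs (with_proj X) x))"
        by (rule card_insert_le_m1) auto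
      also have "\<dots> \<le> Suc N" using N(2)[OF x] card_image_le[OF N(1)[OF x], of snd] by (simp add: out_degree_def)
      finally show ?thesis using card_mono[OF fin sub] finite_subset[OF sub fin] by simp
    qed
    then show "\<exists>N. \<forall>x\<in>pverts X. finite {y \<in> pverts X. graph_dist X x y \<le> 1} \<and> card {y \<in> pverts X. graph_dist X x y \<le> 1} \<le> N"
      by blast
  qed
qed

section \<open>Quasi-isometries preserve thin separating families\<close>

locale quasi_isometry = source: Metric_space M d + target: Metric_space M' d'
  for M :: "'a set" and d and M' :: "'b set" and d' +
  fixes f :: "'a \<Rightarrow> 'b" and K C :: real
  assumes into: "f ` M \<subseteq> M'"
    and K: "1 \<le> K" and C: "0 \<le> C"
    and lower: "x \<in> M \<Longrightarrow> y \<in> M \<Longrightarrow> d x y / K - C \<le> d' (f x) (f y)"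
    and upper: "x \<in> M \<Longrightarrow> y \<in> M \<Longrightarrow> d' (f x) (f y) \<le> K * d x y + C"
    and coarsely_onto: "z \<in> M' \<Longrightarrow> \<exists>x\<in>M. d' z (f x) \<le> C"
begin

lemma lower': "x \<in> M \<Longrightarrow> y \<in> M \<Longrightarrow> d x y \<le> K * (d' (f x) (f y) + C)"
  using lower[of x y] K by (simp add: field_simps)

text \<open>
  Points of \<open>f ` S\<close> at distance at most \<open>r\<close> have preimages in \<open>S\<close> at distance at most \<open>K * (r + C)\<close>.
\<close>

lemma growth_image:
  assumes "\<And>S. S \<in> \<S> \<Longrightarrow> S \<subseteq> M"
  shows "growth M' d' ((`) f ` \<S>) r \<le> growth M d \<S> (K * (r + C))"
proof -
  have "emeasure (count_space UNIV) (target.mcball (f s) r \<inter> f ` S)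
      \<le> growth M d \<S> (K * (r + C))" if S: "S \<in> \<S>" and s: "s \<in> S" for S s
  proof -
    let ?A = "source.mcball s (K * (r + C)) \<inter> S"
    have "target.mcball (f s) r \<inter> f ` S \<subseteq> f ` ?A"
    proof
      fix z assume "z \<in> target.mcball (f s) r \<inter> f ` S"
      then obtain t where t: "t \<in> S" "z = f t" "d' (f s) (f t) \<le> r" by auto
      have M: "s \<in> M" "t \<in> M" using assms S s t by auto
      have "d s t \<le> K * (d' (f s) (f t) + C)" using lower' M by simp
      also have "\<dots> \<le> K * (r + C)" using t K by (intro mult_left_mono) auto
      finally show "z \<in> f ` ?A" using t M by auto
    qed
    then have "emeasure (count_space UNIV) (target.mcball (f s) r \<inter> f ` S)
        \<le> emeasure (count_space UNIV) (f ` ?A)"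
      by (intro emeasure_mono) auto
    also have "\<dots> \<le> emeasure (count_space UNIV) ?A"
      by (cases "finite ?A") (auto simp: emeasure_count_space card_image_le)
    also have "\<dots> \<le> growth M d \<S> (K * (r + C))"
      unfolding growth_def by (rule SUP_upper2[OF S], rule SUP_upper2[OF s]) simp
    finally show ?thesis .
  qed
  then show ?thesis
    unfolding growth_def[of M'] by (auto intro!: SUP_least)
qed

end

text \<open>
  A path in the target that stays far from \<open>f ` S\<close> is shadowed by points of the source, consecutive
  ones at bounded distance. These shadows are joined by geodesics, which are too short to come near
  \<open>S\<close>. So a target path joining the images of two points yields a path joining the points, and
  points separated by \<open>S\<close> have images separated by \<open>f ` S\<close>.
\<close>

lemma (in quasi_isometry) coarsely_separates_image:
  assumes g: "graph_metric M d" and g': "graph_metric M' d'"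
    and sep: "coarsely_separates M d \<S>"
  shows "coarsely_separates M' d' ((`) f ` \<S>)"
proof -
  interpret gs: graph_metric M d by fact
  interpret gt: graph_metric M' d' by fact
  from sep[unfolded source.coarsely_separates_iff] obtain k L where sub: "\<forall>S\<in>\<S>. S \<subseteq> M"
    and k: "k \<ge> 0" and L: "L \<ge> 0" and kc: "coarsely_connected d k M"
    and far: "\<And>D. D \<ge> 0 \<Longrightarrow> \<exists>S\<in>\<S>. \<exists>x \<in> M - neighbourhood M d S L. \<exists>y \<in> M - neighbourhood M d S L.
          dist_to_set d x S \<ge> ereal D \<and> dist_to_set d y S \<ge> ereal D \<and>
          \<not> (coarse_step d k (M - neighbourhood M d S L))\<^sup>*\<^sup>* x y"
    by blast
  \<comment> \<open>Distances are integers, so a graph that is \<open>k\<close>-coarsely connected for some \<open>k < 1\<close> is a point.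
    With \<open>1 \<le> k\<close>, geodesics are \<open>k\<close>-paths.\<close>
  have k1: "1 \<le> k"
  proof (rule ccontr)
    assume nk: "\<not> 1 \<le> k"
    have "x = y" if "(coarse_step d k M)\<^sup>*\<^sup>* x y" for x y
      using that
    proof induction
      case (step y z)
      then have yz: "y \<in> M" "z \<in> M" "d y z \<le> k" by (auto simp: coarse_step_def)
      then obtain n where "d y z = real n" using gs.steps by blast
      with yz nk have "d y z = 0" by auto
      with yz step show ?case by simp
    qed simp
    then have "x = y" if "x \<in> M" "y \<in> M" for x y
      using kc that unfolding coarsely_connected_iff by blast
    with far[of 0] show False by auto
  qed
  \<comment> \<open>\<open>R\<close> bounds the distance between shadows of adjacent points; outside the \<open>L'\<close>-neighbourhood of the
    image, the ball of radius \<open>R\<close> around a shadow misses the \<open>L\<close>-neighbourhood of \<open>S\<close>.\<close>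
  define R where "R = K * (1 + 3 * C)"
  define L' where "L' = K * (L + 1 + R) + 2 * C"
  have R0: "R \<ge> 0" unfolding R_def using K C by simp
  have L'0: "L' \<ge> 0" unfolding L'_def using K C R0 L by simp
  have "\<exists>S\<in>(`) f ` \<S>. \<exists>x \<in> M' - neighbourhood M' d' S L'. \<exists>y \<in> M' - neighbourhood M' d' S L'.
          dist_to_set d' x S \<ge> ereal D \<and> dist_to_set d' y S \<ge> ereal D \<and>
          \<not> (coarse_step d' 1 (M' - neighbourhood M' d' S L'))\<^sup>*\<^sup>* x y" if D: "D \<ge> 0" for D
  proof -
    \<comment> \<open>Images of points at this depth are deeper than both \<open>D\<close> and \<open>L'\<close>.\<close>
    define D' where "D' = K * (D + L' + 1 + C)"
    have "D' \<ge> 0" unfolding D'_def using K C D L'0 by simp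
    from far[OF this] obtain S x y where S: "S \<in> \<S>"
      and x: "x \<in> M - neighbourhood M d S L" and y: "y \<in> M - neighbourhood M d S L"
      and xD: "dist_to_set d x S \<ge> ereal D'" and yD: "dist_to_set d y S \<ge> ereal D'"
      and nj: "\<not> (coarse_step d k (M - neighbourhood M d S L))\<^sup>*\<^sup>* x y"
      by (elim bexE conjE) (rule that)
    let ?N = "M - neighbourhood M d S L" and ?N' = "M' - neighbourhood M' d' (f ` S) L'"
    have SM: "S \<subseteq> M" using sub S by blast
    have farther: "D + L' + 1 \<le> d' (f z) (f s)" if "z \<in> M" "dist_to_set d z S \<ge> ereal D'" "s \<in> S" for z s
    proof -
      have "D' / K \<le> d z s / K" using that K by (intro divide_right_mono) (auto simp: dist_to_set_ge_iff)
      moreover have "D' / K = D + L' + 1 + C" unfolding D'_def using K by simp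
      moreover have "d z s / K - C \<le> d' (f z) (f s)" using lower that SM by blast
      ultimately show ?thesis by linarith
    qed
    have out: "f z \<in> ?N'" if "z \<in> M" "dist_to_set d z S \<ge> ereal D'" for z
      by (rule not_in_neighbourhoodI[of _ _ _ "L' + 1"]) (use farther[OF that] that into D in force)+
    have deep: "dist_to_set d' (f z) (f ` S) \<ge> ereal D" if "z \<in> M" "dist_to_set d z S \<ge> ereal D'" for z
      unfolding dist_to_set_ge_iff using farther[OF that] L'0 by fastforce
    have shadow: "(coarse_step d k ?N)\<^sup>*\<^sup>* u w"
      if "u \<in> M" "w \<in> M" "p \<in> ?N'" "d' p (f u) \<le> C" "q \<in> M'" "d' q (f w) \<le> C" "d' p q \<le> 1" for u w p q
    proof (rule gs.joined_within_ball[of _ _ R])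
      have M': "f u \<in> M'" "f w \<in> M'" "p \<in> M'" using that into by auto
      have "d' (f u) (f w) \<le> d' (f u) p + d' p q + d' q (f w)"
        using target.triangle[of "f u" p "f w"] target.triangle[of p q "f w"] M' that by simp
      then have "d' (f u) (f w) + C \<le> 1 + 3 * C" using that target.commute[of p "f u"] by simp
      then have "K * (d' (f u) (f w) + C) \<le> R" unfolding R_def using K by (intro mult_left_mono) auto
      with lower'[of u w] that show "d u w \<le> R" by simp
      fix z assume z: "z \<in> M" "d u z \<le> R"
      show "z \<in> ?N"
      proof (rule not_in_neighbourhoodI[of _ _ _ "L + 1"])
        fix s assume s: "s \<in> S"
        then have sM: "s \<in> M" "f s \<in> M'" using SM into by auto
        have "L' < d' p (f s)" using not_in_neighbourhood_imp[OF that(3), of "f s"] s by simp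
        moreover have "d' p (f s) \<le> d' p (f u) + d' (f u) (f s)" using target.triangle M' sM by simp
        moreover have "d' (f u) (f s) \<le> K * d u s + C" using upper that sM by simp
        ultimately have "K * (L + 1 + R) \<le> K * d u s" using that unfolding L'_def by linarith
        then have "L + 1 + R \<le> d u s" using K by simp
        moreover have "d u s \<le> d u z + d z s" using source.triangle that z sM by simp
        ultimately show "L + 1 \<le> d z s" using z by linarith
      qed (use z in auto)
    qed (use that k1 in auto)
    have "\<not> (coarse_step d' 1 ?N')\<^sup>*\<^sup>* (f x) (f y)"
    proof
      have "\<forall>w\<in>M. d' q (f w) \<le> C \<longrightarrow> (coarse_step d k ?N)\<^sup>*\<^sup>* x w"
        if "(coarse_step d' 1 ?N')\<^sup>*\<^sup>* (f x) q" for q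
        using that
      proof (induction rule: rtranclp_induct)
        case base
        have "f x \<in> ?N'" using out x xD by blast
        then show ?case using shadow[of x _ "f x" "f x"] x C by (auto simp: into)
      next
        case (step p q)
        then have pq: "p \<in> ?N'" "q \<in> M'" "d' p q \<le> 1" by (auto simp: coarse_step_def)
        then obtain u where u: "u \<in> M" "d' p (f u) \<le> C" using coarsely_onto by blast
        then have "(coarse_step d k ?N)\<^sup>*\<^sup>* x u" using step by blast
        then show ?case using shadow[OF u(1) _ pq(1) u(2) pq(2) _ pq(3)] by (meson rtranclp_trans)
      qed
      moreover assume "(coarse_step d' 1 ?N')\<^sup>*\<^sup>* (f x) (f y)"
      moreover have "d' (f y) (f y) \<le> C" using y C into by auto
      ultimately show False using nj y by blast
    qed
    then show ?thesis using out[of x] out[of y] deep[of x] deep[of y] x y xD yD S by blast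
  qed
  then have "\<exists>k\<ge>0. \<exists>L\<ge>0. coarsely_connected d' k M' \<and>
       (\<forall>D\<ge>0. \<exists>S\<in>(`) f ` \<S>. \<exists>x \<in> M' - neighbourhood M' d' S L. \<exists>y \<in> M' - neighbourhood M' d' S L.
          dist_to_set d' x S \<ge> ereal D \<and> dist_to_set d' y S \<ge> ereal D \<and>
          \<not> (coarse_step d' k (M' - neighbourhood M' d' S L))\<^sup>*\<^sup>* x y)"
    using gt.coarsely_connected_graph L'0 zero_le_one by metis
  moreover have "\<forall>S\<in>(`) f ` \<S>. S \<subseteq> M'" using sub into by (auto dest!: bspec)
  ultimately show ?thesis unfolding target.coarsely_separates_iff by blast
qed

text \<open>
  The image of a family of growth \<open>O(r^c)\<close> separates the graph \<open>Y\<close> that models the class and still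
  has growth \<open>O(r^c)\<close>, which is eventually smaller than any growth of order at least \<open>r powr e\<close>.
\<close>

lemma class_M_not_separated:
  assumes X: "bounded_degree_graph X" and M: "class_M e (pverts X) (graph_dist X)" and ce: "real c < e"
    and sep: "coarsely_separates (pverts X) (graph_dist X) \<S>"
    and big: "growth_bigo (growth (pverts X) (graph_dist X) \<S>) (\<lambda>r. r ^ c)"
  shows False
proof -
  from M obtain Y :: "nat pair_pre_digraph" where Y: "bounded_degree_graph Y"
    and qi: "quasi_isometric (pverts X) (graph_dist X) (pverts Y) (graph_dist Y)"
    and Ygr: "\<And>\<S>. coarsely_separates (pverts Y) (graph_dist Y) \<S> \<Longrightarrow>
           growth_at_least (growth (pverts Y) (graph_dist Y) \<S>) (\<lambda>r. r powr e)"
    unfolding class_M_def by blast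
  interpret X: bounded_graph_metric "pverts X" "graph_dist X" by (rule bounded_graph_metric_graph_dist) fact
  interpret Y: bounded_graph_metric "pverts Y" "graph_dist Y" by (rule bounded_graph_metric_graph_dist) fact
  from qi obtain f K C where "f ` pverts X \<subseteq> pverts Y" "K \<ge> 1" "C \<ge> 0"
    "\<forall>x\<in>pverts X. \<forall>y\<in>pverts X. graph_dist X x y / K - C \<le> graph_dist Y (f x) (f y) \<and> graph_dist Y (f x) (f y) \<le> K * graph_dist X x y + C"
    "\<forall>z\<in>pverts Y. \<exists>x\<in>pverts X. graph_dist Y z (f x) \<le> C"
    unfolding quasi_isometric_def by blast
  then interpret quasi_isometry "pverts X" "graph_dist X" "pverts Y" "graph_dist Y" f K C
    by unfold_locales auto
  let ?V = "growth (pverts Y) (graph_dist Y) ((`) f ` \<S>)"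
  have "coarsely_separates (pverts Y) (graph_dist Y) ((`) f ` \<S>)"
    by (rule coarsely_separates_image) (unfold_locales, fact sep)
  from Ygr[OF this] obtain b where b: "b > 0" "\<And>t. t \<ge> 0 \<Longrightarrow> ?V t \<ge> ennreal (b * (b * t + b) powr e + b)"
    unfolding growth_at_least_def by blast
  from big obtain a where a: "a > 0"
    "\<forall>\<^sub>F r in at_top. growth (pverts X) (graph_dist X) \<S> r \<le> ennreal (a * r ^ c)"
    unfolding growth_bigo_def by blast
  have lim: "filterlim (\<lambda>r. K * (r + C)) at_top at_top"
    using K by (intro filterlim_tendsto_pos_mult_at_top[OF tendsto_const] filterlim_tendsto_add_at_top[OF _ filterlim_ident, of "\<lambda>_. C", simplified add.commute] tendsto_const) auto
  have "\<forall>\<^sub>F r in at_top. ?V r \<le> ennreal (a * (K * (r + C)) ^ c)"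
    using eventually_compose_filterlim[OF a(2) lim]
  proof eventually_elim
    case (elim r)
    have "?V r \<le> growth (pverts X) (graph_dist X) \<S> (K * (r + C))"
      by (rule growth_image) (use sep in \<open>auto simp: coarsely_separates_def\<close>)
    with elim show ?case by (rule order_trans[rotated])
  qed
  moreover have "\<forall>\<^sub>F r in at_top. b * (b * r + b) powr e + b > a * (K * (r + C)) ^ c"
  proof -
    have "((\<lambda>r. (a * (K * (r + C)) ^ c) / ((b * (b * r + b) powr e))) \<longlongrightarrow> 0) at_top"
      using K C b a ce by real_asymp
    then have "\<forall>\<^sub>F r in at_top. (a * (K * (r + C)) ^ c) / ((b * (b * r + b) powr e)) < 1"
      by (rule order_tendstoD) simp
    moreover have "\<forall>\<^sub>F r::real in at_top. r > 0" by (rule eventually_gt_at_top)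
    ultimately show ?thesis
    proof eventually_elim
      case (elim r)
      have "b * r + b > 0" using b(1) elim by (intro add_pos_pos mult_pos_pos) auto
      then have "b * (b * r + b) powr e > 0" using b(1) by (simp add: less_imp_neq[THEN not_sym])
      with elim b show ?case by (simp add: field_simps)
    qed
  qed
  moreover have "\<forall>\<^sub>F r::real in at_top. r \<ge> 0" by (rule eventually_ge_at_top)
  ultimately have "\<forall>\<^sub>F r::real in at_top. False"
  proof eventually_elim
    case (elim r)
    from b(2)[OF elim(3)] elim(1)
    have "ennreal (b * (b * r + b) powr e + b) \<le> ennreal (a * (K * (r + C)) ^ c)" by (rule order_trans)
    moreover have "0 \<le> a * (K * (r + C)) ^ c" using a K C elim by simp
    ultimately show ?case using elim(2) by (simp add: ennreal_le_iff)
  qed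
  then show False by simp
qed

section \<open>Simplicial vertices of chordal graphs\<close>

text \<open>
  The condition that defines chordality, for the induced subgraph on \<open>U\<close>: it passes to
  subsets of the vertex set.
\<close>

definition hole_free :: "('v \<times> 'v) set \<Rightarrow> 'v set \<Rightarrow> bool" where
  "hole_free A U \<longleftrightarrow> \<not> (\<exists>vs. 4 \<le> length vs \<and> distinct vs \<and> set vs \<subseteq> U \<and>
     (\<forall>i<length vs. \<forall>j<length vs. (vs ! i, vs ! j) \<in> A \<longleftrightarrow>
        j = Suc i mod length vs \<or> i = Suc j mod length vs))"

definition simplicial :: "('v \<times> 'v) set \<Rightarrow> 'v set \<Rightarrow> 'v \<Rightarrow> bool" where
  "simplicial A U v \<longleftrightarrow>
     (\<forall>a\<in>U. \<forall>b\<in>U. (v, a) \<in> A \<longrightarrow> (v, b) \<in> A \<longrightarrow> a \<noteq> b \<longrightarrow> (a, b) \<in> A)"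

definition walk_in :: "('v \<times> 'v) set \<Rightarrow> 'v set \<Rightarrow> 'v \<Rightarrow> 'v \<Rightarrow> 'v list \<Rightarrow> bool" where
  "walk_in A C s t p \<longleftrightarrow>
     p \<noteq> [] \<and> hd p = s \<and> last p = t \<and> set p \<subseteq> C \<and> successively (\<lambda>a b. (a, b) \<in> A) p"

lemma walk_in_shortcut:
  assumes p: "walk_in A C s t p" and ij: "i < j" "j < length p"
    and edge: "0 < i \<Longrightarrow> (p ! (i - 1), p ! j) \<in> A" and start: "i = 0 \<Longrightarrow> p ! j = s"
  shows "walk_in A C s t (take i p @ drop j p)"
proof -
  have sub: "set (take i p @ drop j p) \<subseteq> C"
    using p set_take_subset[of i p] set_drop_subset[of j p] by (auto simp: walk_in_def)
  have "successively (\<lambda>a b. (a, b) \<in> A) (take i p @ drop j p @ [])"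
  proof -
    have "successively (\<lambda>a b. (a, b) \<in> A) (take i p)" "successively (\<lambda>a b. (a, b) \<in> A) (drop j p)"
      using p unfolding walk_in_def by (metis append_take_drop_id successively_append_iff)+
    moreover have "(last (take i p), hd (drop j p)) \<in> A" if "take i p \<noteq> []"
    proof -
      have "0 < i" using that by (cases i) auto
      moreover have "last (take i p) = p ! (i - 1)"
        using that ij by (simp add: last_conv_nth)
      ultimately show ?thesis using edge ij by (simp add: hd_drop_conv_nth)
    qed
    ultimately show ?thesis by (auto simp: successively_append_iff)
  qed
  moreover have "hd (take i p @ drop j p) = s"
    using p ij start by (cases "i = 0") (auto simp: walk_in_def hd_drop_conv_nth)
  moreover have "last (take i p @ drop j p) = t" using p ij by (simp add: walk_in_def)
  ultimately show ?thesis using sub ij by (simp add: walk_in_def)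
qed

text \<open>
  A chord or a repeated vertex would give a shortcut.
\<close>

lemma shortest_walk_induced:
  assumes p: "walk_in A C s t p" and min: "\<And>q. walk_in A C s t q \<Longrightarrow> length p \<le> length q"
    and ij: "i < j" "j < length p"
  shows "p ! i \<noteq> p ! j" and "(p ! i, p ! j) \<in> A \<longleftrightarrow> j = Suc i"
proof -
  have succ: "(p ! i, p ! Suc i) \<in> A" if "Suc i < length p" for i
    using p that by (simp add: walk_in_def successively_conv_nth)
  have s: "p ! 0 = s" using p unfolding walk_in_def by (metis hd_conv_nth)
  show "p ! i \<noteq> p ! j"
  proof
    assume eq: "p ! i = p ! j"
    have "walk_in A C s t (take i p @ drop j p)"
    proof (rule walk_in_shortcut[OF p ij])
      assume "0 < i"
      then show "(p ! (i - 1), p ! j) \<in> A" using succ[of "i - 1"] ij eq by simp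
    qed (use eq s in simp)
    from min[OF this] show False using ij by simp
  qed
  have "\<not> Suc i < j" if "(p ! i, p ! j) \<in> A"
  proof
    assume l: "Suc i < j"
    have "walk_in A C s t (take (Suc i) p @ drop j p)"
      by (rule walk_in_shortcut[OF p l ij(2)]) (use that in auto)
    from min[OF this] show False using ij l by simp
  qed
  then show "(p ! i, p ! j) \<in> A \<longleftrightarrow> j = Suc i" using succ[of i] ij by (metis not_less_eq linorder_neqE_nat)
qed

text \<open>
  A shortest walk from \<open>s\<close> to \<open>t\<close> through \<open>C\<close> is an induced path with at least three vertices.
  Since \<open>z\<close> is adjacent to its two ends and to nothing inside \<open>C\<close>, adding \<open>z\<close> closes it to an induced
  cycle of length at least four.
\<close>

lemma no_walk_between_nonadjacent_neighbours:
  assumes sym: "\<And>a b. (a, b) \<in> A \<Longrightarrow> (b, a) \<in> A" and irr: "\<And>a. (a, a) \<notin> A"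
    and hf: "hole_free A U" and C: "C \<subseteq> U" "\<And>c. c \<in> C \<Longrightarrow> c \<noteq> z \<and> (z, c) \<notin> A"
    and z: "z \<in> U" and st: "s \<in> U" "t \<in> U" "(z, s) \<in> A" "(z, t) \<in> A" "s \<noteq> t" "(s, t) \<notin> A"
    and w: "walk_in A (insert s (insert t C)) s t q"
  shows False
proof -
  from ex_has_least_nat[of "walk_in A (insert s (insert t C)) s t", OF w, of length]
  obtain p where p: "walk_in A (insert s (insert t C)) s t p"
    and min: "\<And>q. walk_in A (insert s (insert t C)) s t q \<Longrightarrow> length p \<le> length q" by blast
  note ind = shortest_walk_induced[OF p min]
  define m where "m = length p"
  have ends: "p ! 0 = s" "p ! (m - 1) = t" and p0: "p \<noteq> []"
    using p unfolding walk_in_def m_def by (metis hd_conv_nth, metis last_conv_nth, blast)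
  have m: "m \<ge> 3"
  proof (rule ccontr)
    assume "\<not> m \<ge> 3"
    moreover have "m \<noteq> 0" using p0 by (simp add: m_def)
    ultimately have "m = 1 \<or> m = 2" by linarith
    then show False
    proof
      assume "m = 2"
      then show False using ind(2)[of 0 1] ends st by (simp add: m_def)
    qed (use ends st in simp)
  qed
  have dist: "p ! i = p ! j \<longleftrightarrow> i = j" if "i < m" "j < m" for i j
    using ind(1)[of i j] ind(1)[of j i] that unfolding m_def by (metis linorder_neqE_nat)
  have adj: "(p ! i, p ! j) \<in> A \<longleftrightarrow> j = Suc i \<or> i = Suc j" if "i < m" "j < m" for i j
  proof (cases i j rule: linorder_cases)
    case less
    then show ?thesis using ind(2)[of i j] that by (simp add: m_def)
  next
    case equal
    then show ?thesis using irr by simp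
  next
    case greater
    have "(p ! i, p ! j) \<in> A \<longleftrightarrow> (p ! j, p ! i) \<in> A" using sym by blast
    then show ?thesis using ind(2)[of j i] that greater by (simp add: m_def)
  qed
  have inner: "p ! i \<in> C" if "0 < i" "i < m - 1" for i
  proof -
    have "p ! i \<in> insert s (insert t C)" using p that by (auto simp: walk_in_def m_def subset_iff)
    moreover have "p ! i \<noteq> s" "p ! i \<noteq> t" using dist[of i 0] dist[of i "m - 1"] ends that by auto
    ultimately show ?thesis by simp
  qed
  have zadj: "(z, p ! i) \<in> A \<longleftrightarrow> i = 0 \<or> i = m - 1" if "i < m" for i
  proof (cases "0 < i \<and> i < m - 1")
    case True
    then show ?thesis using inner[of i] C(2)[of "p ! i"] by auto
  next
    case False
    then show ?thesis using ends st that by auto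
  qed
  have zp: "z \<notin> set p" using p C(2) st irr by (auto simp: walk_in_def)
  have next_mod: "Suc i mod Suc m = (if i = m then 0 else Suc i)" if "i < Suc m" for i using that by auto
  let ?vs = "z # p"
  have "(?vs ! i, ?vs ! j) \<in> A \<longleftrightarrow> j = Suc i mod Suc m \<or> i = Suc j mod Suc m"
    if ij: "i < Suc m" "j < Suc m" for i j
  proof (cases i)
    case i: 0
    show ?thesis
    proof (cases j)
      case 0
      then show ?thesis using i irr m by simp
    next
      case (Suc j')
      then show ?thesis using i zadj[of j'] ij next_mod[of j] m by auto
    qed
  next
    case i: (Suc i')
    show ?thesis
    proof (cases j)
      case 0
      have "(p ! i', z) \<in> A \<longleftrightarrow> (z, p ! i') \<in> A" using sym by blast
      then show ?thesis using 0 i zadj[of i'] ij next_mod[of i] m by auto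
    next
      case (Suc j')
      then show ?thesis using i adj[of i' j'] ij next_mod[of i] next_mod[of j] by auto
    qed
  qed
  moreover have "distinct p" using dist by (simp add: distinct_conv_nth m_def)
  then have "distinct ?vs" using zp by simp
  moreover have "set ?vs \<subseteq> U" using p z st C by (auto simp: walk_in_def)
  moreover have "4 \<le> length ?vs" using m by (simp add: m_def)
  moreover have "length ?vs = Suc m" by (simp add: m_def)
  ultimately have "4 \<le> length ?vs \<and> distinct ?vs \<and> set ?vs \<subseteq> U \<and>
     (\<forall>i<length ?vs. \<forall>j<length ?vs. (?vs ! i, ?vs ! j) \<in> A \<longleftrightarrow>
        j = Suc i mod length ?vs \<or> i = Suc j mod length ?vs)" by simp
  then show False using hf unfolding hole_free_def by blast
qed

lemma walk_in_rtrancl: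
  assumes "(a, b) \<in> (A \<inter> C \<times> C)\<^sup>*" "a \<in> C"
  shows "\<exists>p. walk_in A C a b p"
  using assms
proof (induction rule: rtrancl_induct)
  case base
  then show ?case by (intro exI[of _ "[a]"]) (auto simp: walk_in_def)
next
  case (step b c)
  then obtain p where "walk_in A C a b p" by blast
  with step show ?case
    by (intro exI[of _ "p @ [c]"]) (auto simp: walk_in_def successively_append_iff)
qed

text \<open>
  A rooted form of Dirac's theorem. Let \<open>C\<close> be a component of the graph without \<open>z\<close> and its
  neighbours, and \<open>S\<close> the set of vertices outside \<open>C\<close> with a neighbour in \<open>C\<close>. All of \<open>S\<close> is adjacent
  to \<open>z\<close>, so \<open>S\<close> is a clique: two nonadjacent vertices of \<open>S\<close> would close a hole through \<open>z\<close> and \<open>C\<close>.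
  The induction hypothesis for the smaller graph on \<open>C \<union> S\<close> yields a simplicial vertex there; choosing
  the new root so that it is adjacent to the rest of \<open>S\<close> forces this vertex into \<open>C\<close>. All neighbours
  of a vertex of \<open>C\<close> lie in \<open>C \<union> S\<close>, so it is simplicial in the whole graph.
\<close>

lemma simplicial_vertex_far_from:
  assumes sym: "\<And>a b. (a, b) \<in> A \<Longrightarrow> (b, a) \<in> A" and irr: "\<And>a. (a, a) \<notin> A"
    and "finite U" "hole_free A U" "z \<in> U" "\<exists>y\<in>U. y \<noteq> z \<and> (z, y) \<notin> A"
  shows "\<exists>x\<in>U. x \<noteq> z \<and> (z, x) \<notin> A \<and> simplicial A U x"
  using assms(3-)
proof (induction "card U" arbitrary: U z rule: less_induct)
  case less
  define D where "D = {y\<in>U. y \<noteq> z \<and> (z, y) \<notin> A}"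
  obtain y0 where y0: "y0 \<in> D" using less.prems(4) by (auto simp: D_def)
  define C where "C = {y. (y0, y) \<in> (A \<inter> D \<times> D)\<^sup>*}"
  define S where "S = {s\<in>U - C. \<exists>c\<in>C. (s, c) \<in> A}"
  have y0C: "y0 \<in> C" by (simp add: C_def)
  have CD: "C \<subseteq> D"
  proof
    fix y assume "y \<in> C"
    then have "(y0, y) \<in> (A \<inter> D \<times> D)\<^sup>*" by (simp add: C_def)
    then show "y \<in> D" using y0 by (induction rule: rtrancl_induct) auto
  qed
  have CU: "C \<subseteq> U" and SU: "S \<subseteq> U" using CD by (auto simp: D_def S_def)
  have Sz: "(z, s) \<in> A" "s \<noteq> z" if s: "s \<in> S" for s
  proof -
    obtain c where c: "c \<in> C" "(s, c) \<in> A" using s by (auto simp: S_def)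
    then have cD: "c \<in> D" using CD by blast
    show "s \<noteq> z" using c cD by (auto simp: D_def)
    have "s \<notin> D"
    proof
      assume "s \<in> D"
      then have "(c, s) \<in> A \<inter> D \<times> D" using c cD sym by blast
      with c(1) have "s \<in> C" unfolding C_def by (auto intro: rtrancl_into_rtrancl)
      with s show False by (simp add: S_def)
    qed
    then show "(z, s) \<in> A" using s \<open>s \<noteq> z\<close> by (auto simp: D_def S_def)
  qed
  have rsym: "sym ((A \<inter> D \<times> D)\<^sup>*)" by (rule sym_rtrancl) (use sym in \<open>auto simp: sym_def\<close>)
  have in_C: "(c, c') \<in> (A \<inter> C \<times> C)\<^sup>*" if c: "c \<in> C" and "(c, c') \<in> (A \<inter> D \<times> D)\<^sup>*" for c c'
    using that(2)
  proof (induction rule: rtrancl_induct)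
    case (step a b)
    have "(y0, a) \<in> (A \<inter> D \<times> D)\<^sup>*" using c step(1) by (auto simp: C_def)
    then have "a \<in> C" "b \<in> C" using step(2) by (auto simp: C_def intro: rtrancl_into_rtrancl)
    with step show ?case by (auto intro: rtrancl_into_rtrancl)
  qed simp
  have S_clique: "(s, t) \<in> A" if st: "s \<in> S" "t \<in> S" "s \<noteq> t" for s t
  proof (rule ccontr)
    assume nst: "(s, t) \<notin> A"
    obtain c c' where c: "c \<in> C" "(s, c) \<in> A" and c': "c' \<in> C" "(t, c') \<in> A" using st by (auto simp: S_def)
    have "(c, c') \<in> (A \<inter> D \<times> D)\<^sup>*"
      using c(1) c'(1) symD[OF rsym] unfolding C_def by (auto intro: rtrancl_trans)
    from walk_in_rtrancl[OF in_C[OF c(1) this] c(1)] obtain p where p: "walk_in A C c c' p" by blast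
    then have "walk_in A (insert s (insert t C)) s t (s # p @ [t])"
      using c c' sym by (auto simp: walk_in_def successively_append_iff successively_Cons)
    from no_walk_between_nonadjacent_neighbours[OF sym irr less.prems(2) CU _ less.prems(3) _ _ _ _ st(3) nst this]
    show False using CD Sz st SU by (auto simp: D_def)
  qed
  let ?H = "C \<union> S"
  have zH: "z \<notin> ?H" using CD Sz by (auto simp: D_def)
  have HU: "?H \<subseteq> U" using CU SU by blast
  have finH: "finite ?H" using finite_subset[OF HU less.prems(1)] .
  have cardH: "card ?H < card U" by (rule psubset_card_mono) (use HU zH less.prems in auto)
  have hfH: "hole_free A ?H" using less.prems(2) HU unfolding hole_free_def by (meson subset_trans)
  have "\<exists>x\<in>C. simplicial A ?H x"
  proof (cases "\<exists>w\<in>?H. \<exists>y\<in>?H. y \<noteq> w \<and> (w, y) \<notin> A")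
    case False
    then have "simplicial A ?H y0" unfolding simplicial_def by metis
    then show ?thesis using y0C by blast
  next
    case True
    \<comment> \<open>The new root \<open>w\<close>: a vertex of \<open>S\<close> if one of them is not universal in \<open>C \<union> S\<close>, and otherwise any
      vertex that is not universal.\<close>
    have "\<exists>w\<in>?H. (\<exists>y\<in>?H. y \<noteq> w \<and> (w, y) \<notin> A) \<and> (\<forall>x\<in>S. x \<noteq> w \<longrightarrow> (w, x) \<in> A)"
    proof (cases "\<exists>s\<in>S. \<exists>y\<in>?H. y \<noteq> s \<and> (s, y) \<notin> A")
      case True
      then show ?thesis using S_clique by blast
    next
      case F: False
      from True obtain w where w: "w \<in> ?H" "\<exists>y\<in>?H. y \<noteq> w \<and> (w, y) \<notin> A" by blast
      have "(w, x) \<in> A" if x: "x \<in> S" "x \<noteq> w" for x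
      proof (rule sym)
        show "(x, w) \<in> A" using F w(1) x by metis
      qed
      then have "\<forall>x\<in>S. x \<noteq> w \<longrightarrow> (w, x) \<in> A" by simp
      with w(2) have "(\<exists>y\<in>?H. y \<noteq> w \<and> (w, y) \<notin> A) \<and> (\<forall>x\<in>S. x \<noteq> w \<longrightarrow> (w, x) \<in> A)" ..
      then show ?thesis using w(1) by (rule bexI[of _ w])
    qed
    then obtain w where w: "w \<in> ?H" "\<exists>y\<in>?H. y \<noteq> w \<and> (w, y) \<notin> A" "\<forall>x\<in>S. x \<noteq> w \<longrightarrow> (w, x) \<in> A" by blast
    from less.hyps[OF cardH finH hfH w(1,2)] obtain x where
      "x \<in> ?H" "x \<noteq> w" "(w, x) \<notin> A" "simplicial A ?H x" by blast
    with w(3) show ?thesis by blast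
  qed
  then obtain x where x: "x \<in> C" "simplicial A ?H x" by blast
  have "a \<in> ?H" if "a \<in> U" "(x, a) \<in> A" for a
    using that x(1) sym by (auto simp: S_def)
  then have "simplicial A U x" using x(2) unfolding simplicial_def by blast
  then show ?case using x(1) CD by (auto simp: D_def)
qed

lemma simplicial_vertex_exists:
  assumes "\<And>a b. (a, b) \<in> A \<Longrightarrow> (b, a) \<in> A" "\<And>a. (a, a) \<notin> A" "finite U" "hole_free A U" "U \<noteq> {}"
  shows "\<exists>v\<in>U. simplicial A U v"
proof (cases "\<exists>z\<in>U. \<exists>y\<in>U. y \<noteq> z \<and> (z, y) \<notin> A")
  case True
  then show ?thesis using simplicial_vertex_far_from[OF assms(1-4)] by blast
next
  case False
  obtain v where "v \<in> U" using assms(5) by blast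
  moreover have "simplicial A U v" using False unfolding simplicial_def by metis
  ultimately show ?thesis by blast
qed

lemma hole_free_if_chordal:
  assumes "chordal G" "U \<subseteq> pverts G"
  shows "hole_free (parcs G) U"
proof -
  have "induced_cycle G vs"
    if "4 \<le> length vs" "distinct vs" "set vs \<subseteq> U"
      "\<forall>i<length vs. \<forall>j<length vs. (vs ! i, vs ! j) \<in> parcs G \<longleftrightarrow>
        j = Suc i mod length vs \<or> i = Suc j mod length vs" for vs
    unfolding induced_cycle_def by (intro conjI that(2,4)) (use that assms(2) in auto)
  then show ?thesis using assms(1) unfolding hole_free_def chordal_def by blast
qed

section \<open>Words in a presented group\<close>

abbreviation words :: "'v set \<Rightarrow> ('v \<times> bool) list set" where
  "words U \<equiv> lists (U \<times> UNIV)"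

definition inverse_word :: "('v \<times> bool) list \<Rightarrow> ('v \<times> bool) list" where
  "inverse_word w = rev (map (\<lambda>(a, b). (a, \<not> b)) w)"

lemma inverse_word_in_words [simp]: "w \<in> words U \<Longrightarrow> inverse_word w \<in> words U"
  by (auto simp: inverse_word_def in_lists_conv_set)

lemma length_inverse_word [simp]: "length (inverse_word w) = length w"
  by (simp add: inverse_word_def)

lemma inverse_word_inverse_word [simp]: "inverse_word (inverse_word w) = w"
  by (simp add: inverse_word_def rev_map comp_def case_prod_unfold)

context
  fixes U :: "'v set" and R :: "('v \<times> bool) list set"
begin

abbreviation (input) same_element where "same_element \<equiv> presentation_eq U R"

lemmas [trans] = presentation_eq.trans

lemma pe_context:
  assumes "same_element u w" "p \<in> words U" "q \<in> words U"
  shows "same_element (p @ u @ q) (p @ w @ q)"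
  using assms by (intro presentation_eq.append presentation_eq.refl)

lemma pe_append_right: "same_element u w \<Longrightarrow> q \<in> words U \<Longrightarrow> same_element (u @ q) (w @ q)"
  by (intro presentation_eq.append presentation_eq.refl)

lemma pe_append_left: "same_element u w \<Longrightarrow> p \<in> words U \<Longrightarrow> same_element (p @ u) (p @ w)"
  by (intro presentation_eq.append presentation_eq.refl)

lemma pe_inverse_left: "w \<in> words U \<Longrightarrow> same_element (inverse_word w @ w) []"
  unfolding inverse_word_def by (rule presented_inv)

lemma pe_inverse_right: "w \<in> words U \<Longrightarrow> same_element (w @ inverse_word w) []"
  using pe_inverse_left[of "inverse_word w"] by simp

lemma pe_left_cancel:
  assumes "same_element (p @ u) (p @ w)" "p \<in> words U"
  shows "same_element u w"
proof -
  have W: "u \<in> words U" "w \<in> words U" using presentation_eq_words[OF assms(1)] by auto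
  have "same_element ((inverse_word p @ p) @ u) u" "same_element ((inverse_word p @ p) @ w) w"
    using pe_append_right[OF pe_inverse_left[OF assms(2)]] W by (metis append_Nil)+
  moreover have "same_element ((inverse_word p @ p) @ u) ((inverse_word p @ p) @ w)"
    using pe_append_left[OF assms(1), of "inverse_word p"] assms(2) by simp
  ultimately show ?thesis by (meson presentation_eq.sym presentation_eq.trans)
qed

lemma pe_inverse_commute:
  assumes "same_element (u @ w) (w @ u)" "u \<in> words U" "w \<in> words U"
  shows "same_element (inverse_word u @ w) (w @ inverse_word u)"
proof (rule pe_left_cancel)
  have "same_element (u @ inverse_word u @ w) w"
    using pe_append_right[OF pe_inverse_right[OF assms(2)] assms(3)] by simp
  moreover have "same_element (u @ w @ inverse_word u) (w @ u @ inverse_word u)"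
    using pe_append_right[OF assms(1), of "inverse_word u"] assms by simp
  moreover have "same_element (w @ u @ inverse_word u) w"
    using pe_append_left[OF pe_inverse_right[OF assms(2)] assms(3)] by simp
  ultimately show "same_element (u @ inverse_word u @ w) (u @ w @ inverse_word u)"
    by (meson presentation_eq.sym presentation_eq.trans)
qed (use assms in auto)

text \<open>
  Distance at most \<open>n\<close> in the Cayley graph, between words instead of group elements.
\<close>

definition near :: "nat \<Rightarrow> ('v \<times> bool) list \<Rightarrow> ('v \<times> bool) list \<Rightarrow> bool" where
  "near n g h \<longleftrightarrow> (\<exists>e\<in>words U. length e \<le> n \<and> same_element (g @ e) h)"

lemma near_0: "same_element g h \<Longrightarrow> near 0 g h"
  by (auto simp: near_def intro!: bexI[of _ "[]"])

lemma near_mono: "near m g h \<Longrightarrow> m \<le> n \<Longrightarrow> near n g h"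
  unfolding near_def by (meson le_trans)

lemma near_sym:
  assumes "near n g h" shows "near n h g"
proof -
  from assms obtain e where e: "e \<in> words U" "length e \<le> n" "same_element (g @ e) h" by (auto simp: near_def)
  have g: "g \<in> words U" using presentation_eq_words[OF e(3)] by simp
  have "same_element (g @ e @ inverse_word e) g" using pe_append_left[OF pe_inverse_right[OF e(1)] g] by simp
  moreover have "same_element (g @ e @ inverse_word e) (h @ inverse_word e)"
    using pe_append_right[OF e(3), of "inverse_word e"] e by simp
  ultimately have "same_element (h @ inverse_word e) g" by (meson presentation_eq.sym presentation_eq.trans)
  then show ?thesis unfolding near_def using e by (intro bexI[of _ "inverse_word e"]) auto
qed

lemma near_trans:
  assumes "near m g h" "near n h k" shows "near (m + n) g k"
proof -
  from assms obtain e f where e: "e \<in> words U" "length e \<le> m" "same_element (g @ e) h"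
    and f: "f \<in> words U" "length f \<le> n" "same_element (h @ f) k" by (auto simp: near_def)
  have "same_element (g @ e @ f) k" using pe_append_right[OF e(3) f(1)] f(3) by (auto intro: presentation_eq.trans)
  then show ?thesis unfolding near_def using e f by (intro bexI[of _ "e @ f"]) auto
qed

lemma near_left_cancel: "near n (p @ g) (p @ h) \<Longrightarrow> p \<in> words U \<Longrightarrow> near n g h"
  unfolding near_def using pe_left_cancel[of p] by auto

end

section \<open>Crossing parities and words modulo commutation\<close>

definition commutators :: "('v \<times> 'v) set \<Rightarrow> ('v \<times> bool) list set" where
  "commutators A = {[(a, True), (b, True), (a, False), (b, False)] |a b. (a, b) \<in> A}"

text \<open>
  A word \<open>u\<close>, read from \<open>g\<close>, is a path in the Cayley graph. An edge labelled \<open>v\<close> joins some \<open>b\<close> to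
  \<open>b @ [(v, True)]\<close>, and \<open>b\<close> is called its base. The function tells whether the number
  of traversals of edges with base in \<open>W\<close>, in either direction, is odd.
\<close>

fun crosses :: "'v \<Rightarrow> ('v \<times> bool) list set \<Rightarrow> ('v \<times> bool) list \<Rightarrow> ('v \<times> bool) list \<Rightarrow> bool" where
  "crosses v W g [] = False"
| "crosses v W g (s # u) =
     ((fst s = v \<and> (if snd s then g else g @ [s]) \<in> W) \<noteq> crosses v W (g @ [s]) u)"

lemma crosses_append: "crosses v W g (u @ w) = (crosses v W g u \<noteq> crosses v W (g @ u) w)"
  by (induction u arbitrary: g) auto

lemma not_crosses_without: "\<forall>s\<in>set u. fst s \<noteq> v \<Longrightarrow> \<not> crosses v W g u"
  by (induction u arbitrary: g) auto

lemma crosses_split: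
  assumes "crosses v W g u"
  shows "\<exists>b t c. u = b @ t # c \<and> fst t = v \<and> (if snd t then g @ b else g @ b @ [t]) \<in> W"
  using assms
proof (induction u arbitrary: g)
  case (Cons s u)
  show ?case
  proof (cases "fst s = v \<and> (if snd s then g else g @ [s]) \<in> W")
    case True
    then show ?thesis by (intro exI[of _ "[]"] exI[of _ s] exI[of _ u]) auto
  next
    case False
    then have "crosses v W (g @ [s]) u" using Cons.prems unfolding crosses.simps by blast
    from Cons.IH[OF this] obtain b t c where
      "u = b @ t # c" "fst t = v" "(if snd t then (g @ [s]) @ b else (g @ [s]) @ b @ [t]) \<in> W" by blast
    then show ?thesis by (intro exI[of _ "s # b"] exI[of _ t] exI[of _ c]) auto
  qed
qed simp

definition exponent :: "'v \<Rightarrow> ('v \<times> bool) list \<Rightarrow> int" where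
  "exponent a w = (\<Sum>s\<leftarrow>w. if fst s = a then if snd s then 1 else - 1 else 0)"

lemma exponent_simps [simp]:
  "exponent a [] = 0"
  "exponent a (s # w) = (if fst s = a then if snd s then 1 else - 1 else 0) + exponent a w"
  "exponent a (u @ w) = exponent a u + exponent a w"
  by (auto simp: exponent_def)

lemma abs_exponent_le: "\<bar>exponent a w\<bar> \<le> int (length w)"
  by (induction w) auto

text \<open>
  The normal form of the \<open>n\<close>-th power of a letter, for an arbitrary integer \<open>n\<close>.
\<close>

definition letter_power :: "'v \<Rightarrow> int \<Rightarrow> ('v \<times> bool) list" where
  "letter_power a n = replicate (nat \<bar>n\<bar>) (a, 0 \<le> n)"

locale commutation =
  fixes A :: "('v \<times> 'v) set"
  assumes symA: "(a, b) \<in> A \<Longrightarrow> (b, a) \<in> A" and irreflA: "(a, a) \<notin> A"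
begin

abbreviation eqv :: "'v set \<Rightarrow> ('v \<times> bool) list \<Rightarrow> ('v \<times> bool) list \<Rightarrow> bool" where
  "eqv U \<equiv> presentation_eq U (commutators A)"

lemma exponent_eqv: "eqv U u w \<Longrightarrow> exponent a u = exponent a w"
  by (induction rule: presentation_eq.induct) (auto simp: commutators_def)

lemma eqv_mono: "eqv U u w \<Longrightarrow> U \<subseteq> U' \<Longrightarrow> eqv U' u w"
proof (induction rule: presentation_eq.induct)
  case (refl w)
  then show ?case by (intro presentation_eq.refl) auto
next
  case (relator r)
  then show ?case by (intro presentation_eq.relator) auto
qed (auto intro: presentation_eq.sym presentation_eq.trans presentation_eq.append presentation_eq.cancel)

text \<open>
  Deleting letters is a retraction onto the subgroup generated by the remaining ones: a
  commutator with one surviving letter becomes a cancelling pair.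
\<close>

lemma eqv_restrict:
  assumes "eqv U u w" "U' \<subseteq> U"
  shows "eqv U' (filter (\<lambda>s. fst s \<in> U') u) (filter (\<lambda>s. fst s \<in> U') w)"
  using assms
proof (induction rule: presentation_eq.induct)
  case (refl w)
  then show ?case by (intro presentation_eq.refl) auto
next
  case (cancel a b)
  then show ?case by (auto intro: presentation_eq.intros)
next
  case (relator r)
  then obtain a b where r: "r = [(a, True), (b, True), (a, False), (b, False)]" "(a, b) \<in> A"
    by (auto simp: commutators_def)
  have "eqv U' [(c, True), (c, \<not> True)] []" if "c \<in> U'" for c
    by (rule presentation_eq.cancel) fact
  moreover have "eqv U' r []" if "a \<in> U'" "b \<in> U'"
    by (rule presentation_eq.relator) (use r that in \<open>auto simp: commutators_def\<close>)
  ultimately show ?case using r by (auto intro: presentation_eq.refl)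
qed (auto intro: presentation_eq.sym presentation_eq.trans presentation_eq.append)

text \<open>
  The relators say this for two positive letters only. Commuting with a word implies commuting
  with its inverse, which gives the other signs.
\<close>

lemma letters_commute:
  assumes "(a, b) \<in> A" "a \<in> U" "b \<in> U"
  shows "eqv U [(a, x), (b, y)] [(b, y), (a, x)]"
proof -
  note W = assms(2,3)
  have T: "eqv U ([(a, True)] @ [(b, True)]) ([(b, True)] @ [(a, True)])"
  proof -
    have c: "eqv U [(c, False), (c, True)] []" if "c \<in> U" for c
      using presentation_eq.cancel[OF that, of "commutators A" False] by simp
    have "eqv U [(a, True), (b, True), (a, False), (b, False)] []"
      by (rule presentation_eq.relator) (use assms in \<open>auto simp: commutators_def\<close>)
    from pe_append_right[OF this, of "[(b, True), (a, True)]"] W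
    have "eqv U [(a, True), (b, True), (a, False), (b, False), (b, True), (a, True)] [(b, True), (a, True)]"
      by simp
    moreover have "eqv U [(a, True), (b, True), (a, False), (b, False), (b, True), (a, True)]
       [(a, True), (b, True), (a, False), (a, True)]"
      using pe_context[OF c[of b], of "[(a, True), (b, True), (a, False)]" "[(a, True)]"] W by simp
    moreover have "eqv U [(a, True), (b, True), (a, False), (a, True)] [(a, True), (b, True)]"
      using pe_context[OF c[of a], of "[(a, True), (b, True)]" "[]"] W by simp
    ultimately show ?thesis by (simp, meson presentation_eq.sym presentation_eq.trans)
  qed
  have inv: "inverse_word [(c, True)] = [(c, False)]" for c :: 'v by (simp add: inverse_word_def)
  have a: "eqv U ([(a, x)] @ [(b, True)]) ([(b, True)] @ [(a, x)])"
    using T pe_inverse_commute[OF T] W inv by (cases x) auto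
  then have "eqv U ([(b, True)] @ [(a, x)]) ([(a, x)] @ [(b, True)])" by (rule presentation_eq.sym)
  from this pe_inverse_commute[OF this]
  have "eqv U ([(b, y)] @ [(a, x)]) ([(a, x)] @ [(b, y)])" using W inv by (cases y) auto
  then show ?thesis by (auto intro: presentation_eq.sym)
qed

lemma letter_commutes_word:
  assumes "h \<in> words L" "a \<in> U" "L \<subseteq> U" "\<And>b. b \<in> L \<Longrightarrow> (a, b) \<in> A"
  shows "eqv U ((a, x) # h) (h @ [(a, x)])"
  using assms(1)
proof (induction h)
  case (Cons s h)
  obtain b y where s: "s = (b, y)" by force
  then have b: "b \<in> L" using Cons by auto
  have hU: "h \<in> words U" using Cons assms by auto
  have "eqv U ((a, x) # (b, y) # h) ((b, y) # (a, x) # h)"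
    using pe_append_right[OF letters_commute[of a b U x y] hU] b assms by auto
  also have "eqv U \<dots> ((b, y) # h @ [(a, x)])"
    using pe_append_left[OF Cons.IH, of "[(b, y)]"] b assms by auto
  finally show ?case using s by simp
qed (use assms in \<open>auto intro: presentation_eq.refl\<close>)

lemma letter_times_power:
  assumes "a \<in> U"
  shows "eqv U ((a, x) # letter_power a n) (letter_power a ((if x then 1 else - 1) + n))"
proof -
  have W: "letter_power a m \<in> words U" for m using assms by (auto simp: letter_power_def in_lists_conv_set)
  have up: "(a, True) # letter_power a m = letter_power a (1 + m)" if "0 \<le> m" for m
    using that by (auto simp: letter_power_def nat_add_distrib)
  have down: "(a, False) # letter_power a m = letter_power a (m - 1)" if "m \<le> 0" for m
  proof (cases "m = 0")
    case False
    then have "nat \<bar>m - 1\<bar> = Suc (nat \<bar>m\<bar>)" using that by linarith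
    then show ?thesis using False that by (simp add: letter_power_def)
  qed (simp add: letter_power_def)
  show ?thesis
  proof (cases x)
    case True
    show ?thesis
    proof (cases "0 \<le> n")
      case True
      then show ?thesis using \<open>x\<close> W up by (auto intro: presentation_eq.refl)
    next
      case False
      then have "letter_power a n = (a, False) # letter_power a (1 + n)" using down[of "1 + n"] by simp
      then show ?thesis
        using \<open>x\<close> pe_append_right[OF presentation_eq.cancel[OF assms, of "commutators A" True] W[of "1 + n"]] by simp
    qed
  next
    case nx: False
    show ?thesis
    proof (cases "n \<le> 0")
      case True
      then show ?thesis using nx W down by (auto intro: presentation_eq.refl)
    next
      case False
      then have "letter_power a n = (a, True) # letter_power a (n - 1)" using up[of "n - 1"] by simp
      then show ?thesis
        using nx pe_append_right[OF presentation_eq.cancel[OF assms, of "commutators A" False] W[of "n - 1"]] by simp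
    qed
  qed
qed

text \<open>
  A letter that commutes with all others can be moved to the front.
\<close>

lemma collect_letter:
  assumes "u \<in> words (insert a L)" "insert a L \<subseteq> U" "\<And>b. b \<in> L \<Longrightarrow> b \<noteq> a \<Longrightarrow> (a, b) \<in> A"
  shows "eqv U u (letter_power a (exponent a u) @ filter (\<lambda>s. fst s \<noteq> a) u)"
  using assms(1)
proof (induction u)
  case (Cons s u)
  obtain b x where s: "s = (b, x)" by force
  let ?f = "filter (\<lambda>s. fst s \<noteq> a) u" and ?p = "letter_power a (exponent a u)"
  have W: "?f \<in> words U" "?p \<in> words U"
    using Cons assms(2) by (auto simp: letter_power_def in_lists_conv_set)
  have bU: "b \<in> U" using Cons s assms by auto
  have IH: "eqv U (s # u) ([s] @ ?p @ ?f)" using pe_append_left[OF Cons.IH, of "[s]"] bU Cons s by auto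
  show ?case
  proof (cases "b = a")
    case True
    then show ?thesis
      using IH pe_append_right[OF letter_times_power[of a U x "exponent a u"] W(1)] assms s
      by (auto intro: presentation_eq.trans)
  next
    case False
    then have "b \<in> L" using Cons s by auto
    have "eqv U ((b, x) # ?p) (?p @ [(b, x)])"
      by (rule letter_commutes_word[of _ "{a}"])
         (use bU \<open>b \<in> L\<close> False assms symA in \<open>auto simp: letter_power_def in_lists_conv_set\<close>)
    from pe_append_right[OF this W(1)] have "eqv U ([s] @ ?p @ ?f) (?p @ s # ?f)" using s by simp
    with IH show ?thesis using s False by (auto intro: presentation_eq.trans)
  qed
qed (auto intro: presentation_eq.refl simp: letter_power_def)

text \<open>
  The letters of a clique generate a free abelian group, whose elements are determined by their
  exponents. This is what bounds the growth of walls.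
\<close>

lemma eqv_if_exponents_eq:
  assumes "finite L" "L \<subseteq> U" "\<And>a b. a \<in> L \<Longrightarrow> b \<in> L \<Longrightarrow> a \<noteq> b \<Longrightarrow> (a, b) \<in> A"
    and "u \<in> words L" "w \<in> words L" "\<And>a. a \<in> L \<Longrightarrow> exponent a u = exponent a w"
  shows "eqv U u w"
  using assms
proof (induction L arbitrary: u w rule: finite_induct)
  case empty
  then have "u = []" "w = []" by auto
  then show ?case by (auto intro: presentation_eq.refl)
next
  case (insert a L)
  let ?f = "filter (\<lambda>s. fst s \<noteq> a)"
  have c: "eqv U t (letter_power a (exponent a t) @ ?f t)" if "t \<in> words (insert a L)" for t
    by (rule collect_letter[OF that]) (use insert in auto)
  have ex: "exponent b (?f t) = exponent b t" if "b \<noteq> a" for b t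
    using that by (induction t) auto
  have "eqv U (?f u) (?f w)"
  proof (rule insert.IH)
    show "?f u \<in> words L" "?f w \<in> words L" using insert.prems(3,4) by (auto simp: in_lists_conv_set)
    show "exponent b (?f u) = exponent b (?f w)" if "b \<in> L" for b
    proof -
      have "b \<noteq> a" using that insert.hyps by blast
      then show ?thesis using ex insert.prems(5) that by simp
    qed
  qed (use insert.prems in auto)
  moreover have "letter_power a (exponent a u) \<in> words U"
    using insert by (auto simp: letter_power_def in_lists_conv_set)
  ultimately have "eqv U (letter_power a (exponent a u) @ ?f u) (letter_power a (exponent a u) @ ?f w)"
    by (rule pe_append_left)
  with c[OF insert.prems(3)] have "eqv U u (letter_power a (exponent a u) @ ?f w)"
    by (rule presentation_eq.trans)
  moreover have "exponent a u = exponent a w" using insert.prems(5) by simp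
  ultimately show ?case using presentation_eq.sym[OF c[OF insert.prems(4)]]
    by (auto intro: presentation_eq.trans)
qed

end

section \<open>Walls\<close>

text \<open>
  The group on \<open>U\<close> is an HNN extension of the group on \<open>U - {v}\<close>: the stable letter \<open>v\<close>
  commutes with the subgroup generated by its link. The walls below are the edges of the
  Bass--Serre tree of this splitting.
\<close>

locale pivot = commutation A for A :: "('v \<times> 'v) set" +
  fixes U :: "'v set" and v :: 'v
  assumes finU: "finite U" and vU: "v \<in> U"
begin

abbreviation equ :: "('v \<times> bool) list \<Rightarrow> ('v \<times> bool) list \<Rightarrow> bool" where "equ \<equiv> eqv U"

definition link :: "'v set" where "link = {a \<in> U. (v, a) \<in> A}"

lemma link_subset: "link \<subseteq> U" by (auto simp: link_def)

lemma link_words: "h \<in> words link \<Longrightarrow> h \<in> words U"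
  using link_subset by (auto simp: in_lists_conv_set)

text \<open>
  The coset of \<open>p\<close> modulo the subgroup generated by the link. It stands for the set of all edges
  labelled \<open>v\<close> with base in this coset. Since \<open>v\<close> commutes with its link, these edges are parallel.
\<close>

definition wall :: "('v \<times> bool) list \<Rightarrow> ('v \<times> bool) list set" where
  "wall p = {q. \<exists>h\<in>words link. equ (p @ h) q}"

lemma wall_words:
  assumes "q \<in> wall p"
  shows "p \<in> words U \<and> q \<in> words U"
proof -
  from assms obtain h where "equ (p @ h) q" by (auto simp: wall_def)
  from presentation_eq_words[OF this] show ?thesis by simp
qed

lemma in_wall_self: "p \<in> words U \<Longrightarrow> p \<in> wall p"
  by (auto simp: wall_def intro!: bexI[of _ "[]"] presentation_eq.refl)

lemma wall_eqv: "equ q q' \<Longrightarrow> q \<in> wall p \<longleftrightarrow> q' \<in> wall p"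
  unfolding wall_def mem_Collect_eq by (meson presentation_eq.trans presentation_eq.sym)

lemma wall_append_link:
  assumes "h \<in> words link" "q \<in> words U"
  shows "q @ h \<in> wall p \<longleftrightarrow> q \<in> wall p"
proof -
  have *: "q @ h \<in> wall p" if "q \<in> wall p" "h \<in> words link" for q h
  proof -
    from that(1) obtain h' where h': "h' \<in> words link" "equ (p @ h') q" by (auto simp: wall_def)
    then have "equ (p @ h' @ h) (q @ h)" using pe_append_right[OF h'(2) link_words[OF that(2)]] by simp
    with h' that show ?thesis unfolding wall_def by (auto intro!: bexI[of _ "h' @ h"])
  qed
  have "equ (q @ h @ inverse_word h) q"
    using pe_append_left[OF pe_inverse_right[OF link_words[OF assms(1)]] assms(2)] by simp
  then have "q \<in> wall p" if "q @ h \<in> wall p"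
    using *[OF that, of "inverse_word h"] assms wall_eqv by auto
  with * assms show ?thesis by blast
qed

lemma wall_sym: "q \<in> wall p \<Longrightarrow> p \<in> wall q"
proof -
  assume q: "q \<in> wall p"
  then obtain h where h: "h \<in> words link" "equ (p @ h) q" by (auto simp: wall_def)
  have W: "p \<in> words U" "q \<in> words U" using wall_words[OF q] by auto
  have "p @ h \<in> wall q" using wall_eqv[OF h(2)] in_wall_self[OF W(2)] by blast
  then show ?thesis using wall_append_link[OF h(1) W(1)] by blast
qed

lemma wall_eq: assumes "q \<in> wall p" shows "wall q = wall p"
proof -
  have "wall q \<subseteq> wall p" if "q \<in> wall p" for p q
  proof
    fix x assume "x \<in> wall q"
    then obtain h where "h \<in> words link" "equ (q @ h) x" by (auto simp: wall_def)
    then show "x \<in> wall p" using that wall_append_link wall_eqv wall_words by blast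
  qed
  from this[OF assms] this[OF wall_sym[OF assms]] show ?thesis by blast
qed

lemma in_wall_iff: "q \<in> words U \<Longrightarrow> q \<in> wall p \<longleftrightarrow> wall q = wall p"
  using wall_eq in_wall_self by blast

lemma v_commutes_link: "h \<in> words link \<Longrightarrow> equ ((v, x) # h) (h @ [(v, x)])"
  by (rule letter_commutes_word[OF _ vU link_subset]) (auto simp: link_def)

lemma crosses_cong_start:
  assumes "equ g g'" "u \<in> words U"
  shows "crosses v (wall p) g u = crosses v (wall p) g' u"
  using assms
proof (induction u arbitrary: g g')
  case (Cons s u)
  then have "equ (g @ [s]) (g' @ [s])" by (intro pe_append_right) auto
  with Cons show ?case using wall_eqv by auto
qed simp

text \<open>
  The crossing parity depends only on the group element. Cancelling a pair removes two traversals of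
  one edge. In a commutator of \<open>v\<close> with a letter of its link, the two edges labelled \<open>v\<close> belong to the
  same wall, so their traversals cancel modulo two.
\<close>

lemma crosses_cong:
  assumes "equ u u'" "g \<in> words U"
  shows "crosses v (wall p) g u = crosses v (wall p) g u'"
proof -
  let ?W = "wall p"
  from assms(1) have "\<forall>g\<in>words U. crosses v ?W g u = crosses v ?W g u'"
  proof (induction rule: presentation_eq.induct)
    case (append u w u' w')
    note W = presentation_eq_words[OF append.hyps(1)] presentation_eq_words[OF append.hyps(2)]
    show ?case
    proof
      fix g assume g: "g \<in> words U"
      have "crosses v ?W (g @ u) u' = crosses v ?W (g @ w) u'"
        by (rule crosses_cong_start) (use append.hyps g W in \<open>auto intro: pe_append_left\<close>)
      then show "crosses v ?W g (u @ u') = crosses v ?W g (w @ w')"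
        unfolding crosses_append using append.IH g W by auto
    qed
  next
    case (cancel a b)
    show ?case
    proof
      fix g assume g: "g \<in> words U"
      have "equ (g @ [(a, True), (a, False)]) g"
        using pe_append_left[OF presentation_eq.cancel[OF cancel, of "commutators A" True] g] by simp
      then have "g @ [(a, True), (a, False)] \<in> ?W \<longleftrightarrow> g \<in> ?W" by (rule wall_eqv)
      then show "crosses v ?W g [(a, b), (a, \<not> b)] = crosses v ?W g []" by (cases b) auto
    qed
  next
    case (relator r)
    then obtain a b where r: "r = [(a, True), (b, True), (a, False), (b, False)]" and ab: "(a, b) \<in> A"
      by (auto simp: commutators_def)
    with relator have U: "a \<in> U" "b \<in> U" by auto
    have ne: "a \<noteq> b" using ab irreflA by auto
    have comm: "equ [(a, True), (b, True), (a, False)] [(b, True)]"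
    proof -
      have "equ [(a, True), (b, True), (a, False)] [(b, True), (a, True), (a, False)]"
        using pe_append_right[OF letters_commute[OF ab U, of True True], of "[(a, False)]"] U by simp
      also have "equ \<dots> [(b, True)]"
        using pe_append_left[OF presentation_eq.cancel[OF U(1), of "commutators A" True], of "[(b, True)]"] U by simp
      finally show ?thesis .
    qed
    show ?case
    proof
      fix g assume g: "g \<in> words U"
      show "crosses v ?W g r = crosses v ?W g []"
      proof (cases "a = v")
        case True
        then have b: "[(b, True)] \<in> words link" using ab U by (auto simp: link_def)
        have "equ (g @ [(a, True), (b, True), (a, False)]) (g @ [(b, True)])"
          using pe_append_left[OF comm g] .
        then have "g @ [(a, True), (b, True), (a, False)] \<in> ?W \<longleftrightarrow> g \<in> ?W"
          using wall_eqv wall_append_link[OF b g] by blast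
        then show ?thesis using True ne r by auto
      next
        case False
        show ?thesis
        proof (cases "b = v")
          case True
          then have a: "[(a, True)] \<in> words link" using ab U symA by (auto simp: link_def)
          have "equ (g @ r) g" using pe_append_left[OF presentation_eq.relator[OF relator] g] by simp
          then have "g @ r \<in> ?W \<longleftrightarrow> g \<in> ?W" by (rule wall_eqv)
          moreover have "g @ [(a, True)] \<in> ?W \<longleftrightarrow> g \<in> ?W" by (rule wall_append_link[OF a g])
          ultimately show ?thesis using True ne r by auto
        qed (use False r in auto)
      qed
    qed
  qed auto
  with assms show ?thesis by blast
qed

text \<open>
  Membership in the half-space of the wall that does not contain the identity.
\<close>

definition side :: "('v \<times> bool) list set \<Rightarrow> ('v \<times> bool) list \<Rightarrow> bool" where
  "side W g = crosses v W [] g"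

lemma side_append: "side W (g @ u) = (side W g \<noteq> crosses v W g u)"
  by (simp add: side_def crosses_append)

lemma side_cong: "equ g h \<Longrightarrow> side (wall p) g = side (wall p) h"
  unfolding side_def by (rule crosses_cong) auto

text \<open>
  A path between points on different sides has to traverse the wall on its way.
\<close>

lemma near_wall_if_sides_differ:
  assumes "near U (commutators A) n g h" "side (wall p) g \<noteq> side (wall p) h"
  shows "\<exists>q\<in>wall p. near U (commutators A) n g q"
proof -
  from assms(1) obtain e where e: "e \<in> words U" "length e \<le> n" "equ (g @ e) h" by (auto simp: near_def)
  have g: "g \<in> words U" using presentation_eq_words[OF e(3)] by auto
  have "crosses v (wall p) g e" using assms(2) side_cong[OF e(3)] by (auto simp: side_append)
  then obtain b t c where t: "e = b @ t # c" "(if snd t then g @ b else g @ b @ [t]) \<in> wall p"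
    using crosses_split[of v "wall p" g e] by blast
  define e' where "e' = (if snd t then b else b @ [t])"
  have "e' \<in> words U" "length e' \<le> n" "g @ e' \<in> wall p"
    using e t unfolding e'_def by (auto split: if_splits)
  then have "near U (commutators A) n g (g @ e')"
    using g unfolding near_def by (intro bexI[of _ e']) (auto intro!: presentation_eq.refl)
  with \<open>g @ e' \<in> wall p\<close> show ?thesis by blast
qed

text \<open>
  If the edge labelled \<open>v\<close> ends at \<open>g\<close>, then all edges of its wall end in the coset of \<open>g\<close> modulo
  the link.
\<close>

lemma near_wall_tip:
  assumes "q \<in> wall (g @ [(v, False)])"
  shows "\<exists>h\<in>words link. equ (q @ [(v, True)]) (g @ h)"
proof -
  have W: "g \<in> words U" "q \<in> words U" using wall_words[OF assms] by auto
  from assms obtain h where h: "h \<in> words link" "equ (g @ [(v, False)] @ h) q" by (auto simp: wall_def)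
  have hU: "h \<in> words U" using link_words h by blast
  have "equ (q @ [(v, True)]) (g @ [(v, False)] @ h @ [(v, True)])"
    using pe_append_right[OF presentation_eq.sym[OF h(2)], of "[(v, True)]"] vU by simp
  also have "equ \<dots> (g @ [(v, False)] @ [(v, True)] @ h)"
    using pe_append_left[OF presentation_eq.sym[OF v_commutes_link[OF h(1), of True]], of "g @ [(v, False)]"] W vU by simp
  also have "equ \<dots> (g @ h)"
    using pe_context[OF presentation_eq.cancel[OF vU, of "commutators A" False] W(1) hU] by simp
  finally show ?thesis using h by blast
qed

definition vcount :: "('v \<times> bool) list \<Rightarrow> nat" where
  "vcount u = length (filter (\<lambda>s. fst s = v) u)"

lemma vcount_simps [simp]:
  "vcount [] = 0" "vcount (s # u) = (if fst s = v then 1 else 0) + vcount u" "vcount (u @ w) = vcount u + vcount w"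
  by (auto simp: vcount_def)

lemma vcount_link: "h \<in> words link \<Longrightarrow> vcount h = 0"
  using irreflA by (auto simp: vcount_def filter_empty_conv link_def in_lists_conv_set)

lemma vcount_0_iff: "vcount u = 0 \<longleftrightarrow> (\<forall>s\<in>set u. fst s \<noteq> v)"
  by (auto simp: vcount_def filter_empty_conv)

definition edge_base :: "('v \<times> bool) list \<Rightarrow> 'v \<times> bool \<Rightarrow> ('v \<times> bool) list" where
  "edge_base g s = (if snd s then g else g @ [s])"

text \<open>
  Among all words from \<open>c\<close> to \<open>x\<close>, take one with the fewest letters \<open>v\<close>. It crosses its first wall only
  once: a second crossing could be reached from \<open>c @ a\<close> by walking along the wall, with a word in
  the letters of the link, and this would save at least one letter \<open>v\<close>.
\<close>

lemma first_wall_crossed: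
  assumes cu: "equ (c @ a @ s # b) x" and s: "fst s = v" and a: "vcount a = 0"
    and minimal: "\<And>u. u \<in> words U \<Longrightarrow> equ (c @ u) x \<Longrightarrow> vcount (a @ s # b) \<le> vcount u"
  shows "crosses v (wall (edge_base (c @ a) s)) c (a @ s # b)"
proof -
  let ?W = "wall (edge_base (c @ a) s)"
  have W: "c \<in> words U" "a \<in> words U" "s \<in> U \<times> UNIV" "b \<in> words U"
    using presentation_eq_words[OF cu] by auto
  have base: "edge_base (c @ a) s \<in> words U" using W by (auto simp: edge_base_def)
  have "\<not> crosses v ?W (c @ a @ [s]) b"
  proof
    assume "crosses v ?W (c @ a @ [s]) b"
    from crosses_split[OF this] obtain b1 t b2 where b: "b = b1 @ t # b2" "fst t = v"
      "(if snd t then (c @ a @ [s]) @ b1 else (c @ a @ [s]) @ b1 @ [t]) \<in> ?W" by blast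
    have t: "t = (v, snd t)" and s': "s = (v, snd s)" using b s by (cases t, simp, cases s, simp)
    let ?Q0 = "c @ a @ s # b1" and ?Q1 = "c @ a @ s # b1 @ [t]"
    have bW: "b1 \<in> words U" "b2 \<in> words U" "t \<in> U \<times> UNIV" using W(4) b by auto
    \<comment> \<open>\<open>c @ a\<close> is the base of the first edge if \<open>s\<close> is positive, and its tip otherwise. Bases of the wall
      form one coset of the link and tips another, so \<open>c @ a\<close> shares its coset with the base or the tip of
      the second edge, which is \<open>?Q0\<close> or \<open>?Q1\<close>.\<close>
    have "\<exists>h\<in>words link. equ (c @ a @ h) ?Q0 \<or> equ (c @ a @ h) ?Q1"
    proof (cases "snd s")
      case True
      then have "?W = wall (c @ a)" by (simp add: edge_base_def)
      then show ?thesis using b(3) by (auto simp: wall_def split: if_splits)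
    next
      case False
      then have sF: "s = (v, False)" and Weq: "?W = wall ((c @ a) @ [(v, False)])"
        using s' by (auto simp: edge_base_def)
      show ?thesis
      proof (cases "snd t")
        case True
        then have "?Q0 \<in> ?W" "t = (v, True)" using b t by auto
        then show ?thesis using near_wall_tip[of ?Q0 "c @ a"] unfolding Weq by (auto intro: presentation_eq.sym)
      next
        case False
        then have Q1: "?Q1 \<in> ?W" "t = (v, False)" using b t by auto
        have "equ (?Q1 @ [(v, True)]) ?Q0"
          using pe_append_left[OF presentation_eq.cancel[OF vU, of "commutators A" False], of ?Q0] Q1 W bW by simp
        moreover obtain h where "h \<in> words link" "equ (?Q1 @ [(v, True)]) ((c @ a) @ h)"
          using near_wall_tip[of ?Q1 "c @ a"] Q1(1) unfolding Weq by blast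
        ultimately have "h \<in> words link \<and> equ (c @ a @ h) ?Q0"
          by (auto intro: presentation_eq.trans presentation_eq.sym)
        then show ?thesis by blast
      qed
    qed
    then obtain h where h: "h \<in> words link" and or: "equ (c @ a @ h) ?Q0 \<or> equ (c @ a @ h) ?Q1" by blast
    have hU: "h \<in> words U" using link_words h by blast
    have "\<exists>r. r \<in> words U \<and> equ (c @ a @ h @ r) x \<and> vcount r \<le> vcount (t # b2)"
      using or
    proof
      assume "equ (c @ a @ h) ?Q0"
      from pe_append_right[OF this, of "t # b2"] bW
      have "equ (c @ a @ h @ t # b2) (c @ a @ s # b)" using b by simp
      with cu bW show ?thesis by (intro exI[of _ "t # b2"]) (auto intro: presentation_eq.trans)
    next
      assume "equ (c @ a @ h) ?Q1"
      from pe_append_right[OF this, of b2] bW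
      have "equ (c @ a @ h @ b2) (c @ a @ s # b)" using b by simp
      with cu bW show ?thesis by (intro exI[of _ b2]) (auto intro: presentation_eq.trans)
    qed
    then obtain r where r: "r \<in> words U" "equ (c @ a @ h @ r) x" "vcount r \<le> vcount (t # b2)" by blast
    have "vcount (a @ s # b) \<le> vcount (a @ h @ r)" by (rule minimal) (use W hU r in auto)
    then show False using r(3) vcount_link[OF h] s b by simp
  qed
  moreover have "\<not> crosses v ?W c a" using not_crosses_without a by (simp add: vcount_0_iff)
  moreover have "crosses v ?W (c @ a) [s]"
    using in_wall_self[OF base] s by (simp add: edge_base_def split: if_splits)
  ultimately show ?thesis using crosses_append[of v ?W c "a @ [s]" b] crosses_append[of v ?W c a "[s]"] by simp
qed

lemma crossing_one_edge:
  assumes "c \<in> words U" "a \<in> words U" "vcount a = 0" "fst s = v" "p \<in> words U"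
  shows "crosses v (wall p) c (a @ [s]) \<longleftrightarrow> wall p = wall (edge_base (c @ a) s)"
proof -
  have "edge_base (c @ a) s \<in> words U" using assms vU by (cases s) (auto simp: edge_base_def)
  then have "edge_base (c @ a) s \<in> wall p \<longleftrightarrow> wall p = wall (edge_base (c @ a) s)"
    using in_wall_iff[of "edge_base (c @ a) s" p] by auto
  moreover have "\<not> crosses v (wall p) c a" using not_crosses_without assms by (simp add: vcount_0_iff)
  ultimately show ?thesis using assms(4) by (simp add: crosses_append edge_base_def)
qed

end

section \<open>Pushing a coarse embedding off a simplicial generator\<close>

text \<open>
  A coarse embedding of a graph into the group on \<open>U\<close>, in terms of representing words. The
  upper control function is linear in a graph, so it suffices to control points at distance one. The lower
  control function tends to infinity iff bounded sets have bounded preimages, uniformly.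
\<close>

definition word_embedding ::
    "('v \<times> 'v) set \<Rightarrow> 'v set \<Rightarrow> 'a set \<Rightarrow> ('a \<Rightarrow> 'a \<Rightarrow> real) \<Rightarrow> ('a \<Rightarrow> ('v \<times> bool) list) \<Rightarrow> bool" where
  "word_embedding A U M d \<rho> \<longleftrightarrow>
     (\<forall>x\<in>M. \<rho> x \<in> words U) \<and>
     (\<exists>K. \<forall>x\<in>M. \<forall>y\<in>M. d x y \<le> 1 \<longrightarrow> near U (commutators A) K (\<rho> x) (\<rho> y)) \<and>
     (\<forall>n. \<exists>R. \<forall>x\<in>M. \<forall>y\<in>M. near U (commutators A) n (\<rho> x) (\<rho> y) \<longrightarrow> d x y \<le> R)"

context commutation
begin

lemma near_superset: "near U' (commutators A) n g h \<Longrightarrow> U' \<subseteq> U \<Longrightarrow> near U (commutators A) n g h"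
  unfolding near_def using eqv_mono by (meson lists_mono Sigma_mono order_refl subsetD)

text \<open>
  Because of the retraction that deletes letters, the subgroup on \<open>U'\<close> is undistorted.
\<close>

lemma near_subset:
  assumes "near U (commutators A) n g h" "U' \<subseteq> U" "g \<in> words U'" "h \<in> words U'"
  shows "near U' (commutators A) n g h"
proof -
  from assms(1) obtain e where e: "e \<in> words U" "length e \<le> n" "eqv U (g @ e) h" by (auto simp: near_def)
  let ?f = "filter (\<lambda>s. fst s \<in> U')"
  have id: "?f w = w" if "w \<in> words U'" for w
    using that by (auto simp: filter_id_conv in_lists_conv_set)
  have "eqv U' (?f (g @ e)) (?f h)" by (rule eqv_restrict[OF e(3) assms(2)])
  then have "eqv U' (g @ ?f e) h" using id assms by simp
  moreover have "?f e \<in> words U'" using e by (auto simp: in_lists_conv_set)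
  moreover have "length (?f e) \<le> n" using e(2) length_filter_le le_trans by blast
  ultimately show ?thesis unfolding near_def by blast
qed

end

locale wall_traces = bounded_graph_metric M d + pivot A U v
  for M :: "'a set" and d and A :: "('v \<times> 'v) set" and U v +
  fixes \<rho> :: "'a \<Rightarrow> ('v \<times> bool) list" and K :: nat
  assumes link_clique: "a \<in> link \<Longrightarrow> b \<in> link \<Longrightarrow> a \<noteq> b \<Longrightarrow> (a, b) \<in> A"
    and \<rho>_words: "x \<in> M \<Longrightarrow> \<rho> x \<in> words U"
    and \<rho>_unit: "x \<in> M \<Longrightarrow> y \<in> M \<Longrightarrow> d x y \<le> 1 \<Longrightarrow> near U (commutators A) K (\<rho> x) (\<rho> y)"
    and \<rho>_proper: "\<exists>R. \<forall>x\<in>M. \<forall>y\<in>M. near U (commutators A) n (\<rho> x) (\<rho> y) \<longrightarrow> d x y \<le> R"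
begin

abbreviation near_U where "near_U \<equiv> near U (commutators A)"

lemma near_\<rho>:
  assumes "x \<in> M" "y \<in> M" "d x y \<le> real n"
  shows "near_U (K * n) (\<rho> x) (\<rho> y)"
proof -
  have *: "near_U (K * m) (\<rho> x) (\<rho> y)" if "(coarse_step d 1 M ^^ m) x y" for m y
    using that
  proof (induction m arbitrary: y)
    case 0
    then show ?case using assms \<rho>_words by (auto intro!: near_0 presentation_eq.refl)
  next
    case (Suc m)
    then obtain z where z: "(coarse_step d 1 M ^^ m) x z" "coarse_step d 1 M z y" by (auto elim: relpowp_Suc_E)
    then have "near_U K (\<rho> z) (\<rho> y)" using \<rho>_unit by (auto simp: coarse_step_def)
    from near_trans[OF Suc.IH[OF z(1)] this] show ?case by (simp add: add.commute)
  qed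
  from steps[OF assms(1,2)] obtain m where m: "d x y = real m" "(coarse_step d 1 M ^^ m) x y" by blast
  with assms have "m \<le> n" by simp
  then show ?thesis using near_mono[OF *[OF m(2)]] by simp
qed

text \<open>
  The radius \<open>K\<close> makes sure that two adjacent points outside of the trace of a wall lie on
  the same side of it.
\<close>

definition wall_trace :: "('v \<times> bool) list set \<Rightarrow> 'a set" where
  "wall_trace W = {x\<in>M. \<exists>q\<in>W. near_U K (\<rho> x) q}"

definition wall_trace_family :: "'a set set" where
  "wall_trace_family = (\<lambda>p. wall_trace (wall p)) ` words U"

text \<open>
  Each point of the trace is assigned an element of the coset nearby, and relative to the one
  assigned to \<open>s\<close> it is given by its exponents, one for each vertex of the link. Inside a
  ball of radius \<open>n\<close> these exponents are at most \<open>2 * K + K * n\<close> in absolute value. Points with the same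
  exponents are close in the group, hence close in \<open>M\<close>, so that at most \<open>N\<close> of them share a vector.
\<close>

lemma wall_trace_ball_card:
  "\<exists>N. \<forall>p\<in>words U. \<forall>s\<in>wall_trace (wall p). \<forall>n. finite {x\<in>wall_trace (wall p). d s x \<le> real n} \<and>
     card {x\<in>wall_trace (wall p). d s x \<le> real n} \<le> N * (2 * (2 * K + K * n) + 1) ^ card link"
proof -
  obtain R where R: "\<And>x y. x \<in> M \<Longrightarrow> y \<in> M \<Longrightarrow> near_U (K + K) (\<rho> x) (\<rho> y) \<Longrightarrow> d x y \<le> R"
    using \<rho>_proper by blast
  obtain N where N: "\<And>x. x \<in> M \<Longrightarrow> finite {y\<in>M. d x y \<le> R}" "\<And>x. x \<in> M \<Longrightarrow> card {y\<in>M. d x y \<le> R} \<le> N"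
    using balls_bounded by blast
  have fin_link: "finite link" using finU link_subset finite_subset by blast
  have "finite {x\<in>wall_trace (wall p). d s x \<le> real n} \<and>
     card {x\<in>wall_trace (wall p). d s x \<le> real n} \<le> N * (2 * (2 * K + K * n) + 1) ^ card link"
    if p: "p \<in> words U" and s: "s \<in> wall_trace (wall p)" for p s n
  proof -
    have "\<exists>h\<in>words link. near_U K (\<rho> x) (p @ h)" if "x \<in> wall_trace (wall p)" for x
    proof -
      from that obtain q h where q: "near_U K (\<rho> x) q" "h \<in> words link" "equ (p @ h) q"
        by (auto simp: wall_trace_def wall_def)
      from near_trans[OF q(1) near_0[OF presentation_eq.sym[OF q(3)]]] q(2) show ?thesis by auto
    qed
    then obtain h where h: "\<And>x. x \<in> wall_trace (wall p) \<Longrightarrow> h x \<in> words link"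
      "\<And>x. x \<in> wall_trace (wall p) \<Longrightarrow> near_U K (\<rho> x) (p @ h x)" by metis
    define m where "m = 2 * K + K * n"
    define B where "B = {x\<in>wall_trace (wall p). d s x \<le> real n}"
    define F where "F x = (\<lambda>a\<in>link. exponent a (h x) - exponent a (h s))" for x
    let ?I = "PiE link (\<lambda>_. {- int m..int m})"
    have BM: "x \<in> M" if "x \<in> B" for x using that by (auto simp: B_def wall_trace_def)
    have sM: "s \<in> M" using s by (auto simp: wall_trace_def)
    have FI: "F x \<in> ?I" if x: "x \<in> B" for x
    proof -
      have xt: "x \<in> wall_trace (wall p)" "d s x \<le> real n" using x by (auto simp: B_def)
      have "near_U (K + (K * n + K)) (p @ h s) (p @ h x)"
        by (rule near_trans[OF near_sym[OF h(2)[OF s]] near_trans[OF near_\<rho>[OF sM BM[OF x] xt(2)] h(2)[OF xt(1)]]])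
      then have "near_U m (h s) (h x)" using near_left_cancel p by (simp add: m_def mult_2 add_ac)
      then obtain e where e: "length e \<le> m" "equ (h s @ e) (h x)" by (auto simp: near_def)
      have "- int m \<le> exponent a (h x) - exponent a (h s) \<and> exponent a (h x) - exponent a (h s) \<le> int m" for a
        using exponent_eqv[OF e(2), of a] abs_exponent_le[of a e] e(1) by auto
      then show ?thesis by (auto simp: F_def)
    qed
    have fibre: "{x\<in>B. F x = t} \<subseteq> {y\<in>M. d z y \<le> R}" if z: "z \<in> B" "F z = t" for z t
    proof
      fix x assume x: "x \<in> {x\<in>B. F x = t}"
      then have xz: "x \<in> wall_trace (wall p)" "z \<in> wall_trace (wall p)" using z by (auto simp: B_def)
      have eq: "F z = F x" using x z by simp
      have "equ (h z) (h x)"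
      proof (rule eqv_if_exponents_eq[OF fin_link link_subset link_clique])
        fix a assume "a \<in> link"
        with fun_cong[OF eq, of a] show "exponent a (h z) = exponent a (h x)" by (simp add: F_def)
      qed (use h xz in auto)
      then have "equ (p @ h z) (p @ h x)" using p by (rule pe_append_left)
      from near_trans[OF near_trans[OF h(2)[OF xz(2)] near_0[OF this]] near_sym[OF h(2)[OF xz(1)]]]
      have "near_U (K + K) (\<rho> z) (\<rho> x)" by simp
      then show "x \<in> {y\<in>M. d z y \<le> R}" using R BM x z by auto
    qed
    have fibre_card: "finite {x\<in>B. F x = t} \<and> card {x\<in>B. F x = t} \<le> N" for t
    proof (cases "\<exists>z\<in>B. F z = t")
      case True
      then obtain z where z: "z \<in> B" "F z = t" by blast
      have "card {x\<in>B. F x = t} \<le> card {y\<in>M. d z y \<le> R}"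
        by (rule card_mono[OF N(1)[OF BM[OF z(1)]] fibre[OF z]])
      then show ?thesis using N[OF BM[OF z(1)]] fibre[OF z] finite_subset by (meson le_trans)
    next
      case False
      then have e: "{x\<in>B. F x = t} = {}" by blast
      show ?thesis unfolding e by simp
    qed
    have Beq: "B = (\<Union>t\<in>?I. {x\<in>B. F x = t})" using FI by blast
    have finI: "finite ?I" by (rule finite_PiE) (use fin_link in auto)
    have "card B = card (\<Union>t\<in>?I. {x\<in>B. F x = t})" using Beq by simp
    also have "\<dots> \<le> (\<Sum>t\<in>?I. card {x\<in>B. F x = t})" by (rule card_UN_le[OF finI])
    also have "\<dots> \<le> (\<Sum>t\<in>?I. N)" by (rule sum_mono) (use fibre_card in auto)
    also have "\<dots> = N * (2 * m + 1) ^ card link"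
      using fin_link by (simp add: card_PiE nat_add_distrib nat_mult_distrib mult.commute)
    finally have "card B \<le> N * (2 * m + 1) ^ card link" .
    moreover have "finite B" using finI fibre_card by (subst Beq) blast
    ultimately show ?thesis unfolding B_def m_def by blast
  qed
  then show ?thesis by blast
qed

lemma wall_trace_family_growth:
  assumes "card link \<le> c"
  shows "growth_bigo (growth M d wall_trace_family) (\<lambda>r. r ^ c)"
proof -
  obtain N where N: "\<And>p s n. p \<in> words U \<Longrightarrow> s \<in> wall_trace (wall p) \<Longrightarrow> finite {x\<in>wall_trace (wall p). d s x \<le> real n}"
    "\<And>p s n. p \<in> words U \<Longrightarrow> s \<in> wall_trace (wall p) \<Longrightarrow>
     card {x\<in>wall_trace (wall p). d s x \<le> real n} \<le> N * (2 * (2 * K + K * n) + 1) ^ card link"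
    using wall_trace_ball_card by blast
  \<comment> \<open>For \<open>1 \<le> r\<close> and \<open>n = \<lceil>r\<rceil> \<le> 2 * r\<close>, the base \<open>2 * (2 * K + K * n) + 1\<close> is at most
    \<open>(8 * K + 1) * r\<close>.\<close>
  define C where "C = real N * (8 * real K + 1) ^ card link + 1"
  have "growth M d wall_trace_family r \<le> ennreal (C * r ^ c)" if r: "1 \<le> r" for r
    unfolding growth_def
  proof (intro SUP_least)
    fix S s assume "S \<in> wall_trace_family" and s: "s \<in> S"
    then obtain p where p: "p \<in> words U" "S = wall_trace (wall p)" by (auto simp: wall_trace_family_def)
    define n where "n = nat \<lceil>r\<rceil>"
    have n: "r \<le> real n" "real n \<le> 2 * r" using r unfolding n_def by linarith+
    let ?B = "{x\<in>wall_trace (wall p). d s x \<le> real n}"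
    have fin: "finite ?B" and cB: "card ?B \<le> N * (2 * (2 * K + K * n) + 1) ^ card link"
      using N[OF p(1), of s n] s p(2) by auto
    have "emeasure (count_space UNIV) (mcball s r \<inter> S) \<le> emeasure (count_space UNIV) ?B"
      by (rule emeasure_mono) (use p n in auto)
    also have "\<dots> = ennreal (real (card ?B))" using fin by (simp add: emeasure_count_space ennreal_of_nat_eq_real_of_nat)
    also have "\<dots> \<le> ennreal (C * r ^ c)"
    proof (rule ennreal_leI)
      have "real K * real n \<le> real K * (2 * r)" using n by (intro mult_left_mono) auto
      moreover have "real K \<le> real K * r" using r by (simp add: mult_le_cancel_left1)
      ultimately have lin: "2 * (2 * real K + real K * real n) + 1 \<le> (8 * real K + 1) * r"
        using r by (simp add: algebra_simps)
      have "real (card ?B) \<le> real N * (2 * (2 * real K + real K * real n) + 1) ^ card link"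
        using of_nat_mono[OF cB, where 'a = real] by (simp add: add_ac)
      also have "\<dots> \<le> real N * ((8 * real K + 1) * r) ^ card link"
        using lin by (intro mult_left_mono power_mono) auto
      also have "\<dots> = real N * (8 * real K + 1) ^ card link * r ^ card link" by (simp add: power_mult_distrib)
      also have "\<dots> \<le> real N * (8 * real K + 1) ^ card link * r ^ c"
        using r assms by (intro mult_left_mono power_increasing) auto
      also have "\<dots> \<le> C * r ^ c" unfolding C_def using r by (intro mult_right_mono) auto
      finally show "real (card ?B) \<le> C * r ^ c" .
    qed
    finally show "emeasure (count_space UNIV) (mcball s r \<inter> S) \<le> ennreal (C * r ^ c)" .
  qed
  then have "\<forall>\<^sub>F r in at_top. growth M d wall_trace_family r \<le> ennreal (C * r ^ c)"
    by (rule eventually_mono[OF eventually_ge_at_top[of 1]])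
  moreover have "C > 0" unfolding C_def by (simp add: add_nonneg_pos)
  ultimately show ?thesis unfolding growth_bigo_def by (intro exI[of _ C] conjI)
qed

lemma sides_joined_outside_trace:
  assumes "(coarse_step d 1 (M - neighbourhood M d (wall_trace (wall p)) 0))\<^sup>*\<^sup>* x y"
  shows "side (wall p) (\<rho> x) = side (wall p) (\<rho> y)"
  using assms
proof induction
  case (step y z)
  then have yz: "y \<in> M" "y \<notin> neighbourhood M d (wall_trace (wall p)) 0" "z \<in> M" "d y z \<le> 1"
    by (auto simp: coarse_step_def)
  have "y \<notin> wall_trace (wall p)"
  proof
    assume "y \<in> wall_trace (wall p)"
    then have "dist_to_set d y (wall_trace (wall p)) \<le> ereal (d y y)" unfolding dist_to_set_def by (rule INF_lower)
    with yz show False by (simp add: neighbourhood_def zero_ereal_def)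
  qed
  then have "side (wall p) (\<rho> y) = side (wall p) (\<rho> z)"
    using near_wall_if_sides_differ[OF \<rho>_unit[OF yz(1,3,4)]] yz(1) by (auto simp: wall_trace_def)
  with step.IH show ?case by simp
qed simp

text \<open>
  If the traces do not separate, then every wall has a side \<open>\<sigma>\<close> such that all points on the other
  side are uniformly close to the wall: two deep points on different sides would lie
  in different components of the complement of the trace.
\<close>

lemma shallow_sides:
  assumes nsep: "\<not> coarsely_separates M d wall_trace_family"
  shows "\<exists>n. \<forall>p\<in>words U. \<exists>\<sigma>. \<forall>x\<in>M. side (wall p) (\<rho> x) \<noteq> \<sigma> \<longrightarrow> (\<exists>q\<in>wall p. near_U n (\<rho> x) q)"
proof -
  have "\<forall>S\<in>wall_trace_family. S \<subseteq> M" by (auto simp: wall_trace_family_def wall_trace_def)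
  with nsep have "\<not> (\<forall>D\<ge>0. \<exists>S\<in>wall_trace_family. \<exists>x \<in> M - neighbourhood M d S 0. \<exists>y \<in> M - neighbourhood M d S 0.
          dist_to_set d x S \<ge> ereal D \<and> dist_to_set d y S \<ge> ereal D \<and>
          \<not> (coarse_step d 1 (M - neighbourhood M d S 0))\<^sup>*\<^sup>* x y)"
    unfolding coarsely_separates_iff using coarsely_connected_graph zero_le_one order_refl by metis
  then obtain D where D: "\<And>S x y. S \<in> wall_trace_family \<Longrightarrow> x \<in> M - neighbourhood M d S 0 \<Longrightarrow>
      y \<in> M - neighbourhood M d S 0 \<Longrightarrow> dist_to_set d x S \<ge> ereal D \<Longrightarrow> dist_to_set d y S \<ge> ereal D \<Longrightarrow>
      (coarse_step d 1 (M - neighbourhood M d S 0))\<^sup>*\<^sup>* x y"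
    by blast
  define m where "m = nat \<lceil>max D 1\<rceil>"
  have m: "D \<le> real m" "1 \<le> real m" unfolding m_def by linarith+
  have "\<exists>\<sigma>. \<forall>x\<in>M. side (wall p) (\<rho> x) \<noteq> \<sigma> \<longrightarrow> (\<exists>q\<in>wall p. near_U (K * m + K) (\<rho> x) q)"
    if p: "p \<in> words U" for p
  proof -
    let ?S = "wall_trace (wall p)"
    have S: "?S \<in> wall_trace_family" using p by (auto simp: wall_trace_family_def)
    define deep where "deep x \<longleftrightarrow> x \<in> M \<and> (\<forall>s\<in>?S. real m \<le> d x s)" for x
    have same: "side (wall p) (\<rho> x) = side (wall p) (\<rho> y)" if "deep x" "deep y" for x y
    proof -
      have "z \<in> M - neighbourhood M d ?S 0" if "deep z" for z
        by (rule not_in_neighbourhoodI[of _ _ _ "real m"]) (use that m in \<open>auto simp: deep_def\<close>)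
      moreover have "dist_to_set d z ?S \<ge> ereal D" if "deep z" for z
        using that m unfolding deep_def dist_to_set_ge_iff by force
      ultimately show ?thesis using D[OF S] that by (intro sides_joined_outside_trace) blast
    qed
    have shallow: "\<exists>q\<in>wall p. near_U (K * m + K) (\<rho> x) q" if "x \<in> M" "\<not> deep x" for x
    proof -
      from that obtain s where s: "s \<in> ?S" "d x s \<le> real m" unfolding deep_def by force
      then obtain q where q: "s \<in> M" "q \<in> wall p" "near_U K (\<rho> s) q" by (auto simp: wall_trace_def)
      from near_trans[OF near_\<rho>[OF that(1) q(1) s(2)] q(3)] q(2) show ?thesis by blast
    qed
    \<comment> \<open>All deep points are on the same side; without deep points, either side will do.\<close>
    define \<sigma> where "\<sigma> = (\<exists>x. deep x \<and> side (wall p) (\<rho> x))"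
    have "\<not> deep x" if "side (wall p) (\<rho> x) \<noteq> \<sigma>" for x
      using that same unfolding \<sigma>_def by blast
    with shallow show ?thesis by blast
  qed
  then show ?thesis by blast
qed

lemma words_without_v: "u \<in> words U \<Longrightarrow> vcount u = 0 \<Longrightarrow> u \<in> words (U - {v})"
  by (auto simp: vcount_0_iff in_lists_conv_set)

text \<open>
  Orient every wall towards its side \<open>\<sigma>\<close>. Only finitely many walls point away from the image of a
  given point, as all of them are close to it. Choose \<open>c\<close> with as few such walls as possible.
  Crossing a wall adjacent to the coset of \<open>c\<close> changes the side with respect to this wall alone, so by
  minimality all walls adjacent to the coset point towards it. A point outside of the coset is
  beyond one of them, on its shallow side, and therefore close to it and to the coset. In terms of the
  Bass--Serre tree, the orientation has a sink.
\<close>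

lemma near_coset:
  assumes "M \<noteq> {}"
    and sh: "\<And>p x. p \<in> words U \<Longrightarrow> x \<in> M \<Longrightarrow> side (wall p) (\<rho> x) \<noteq> \<sigma> (wall p) \<Longrightarrow> \<exists>q\<in>wall p. near_U n (\<rho> x) q"
  shows "\<exists>c\<in>words U. \<forall>x\<in>M. \<exists>u\<in>words (U - {v}). near_U (n + 1) (\<rho> x) (c @ u)"
proof -
  define bad where "bad c = {W \<in> wall ` words U. side W c \<noteq> \<sigma> W}" for c
  have "\<exists>c. c \<in> words U \<and> finite (bad c)"
  proof -
    obtain x where x: "x \<in> M" using assms by blast
    have "bad (\<rho> x) \<subseteq> (\<lambda>e. wall (\<rho> x @ e)) ` {e. set e \<subseteq> U \<times> UNIV \<and> length e \<le> n}"
    proof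
      fix W assume "W \<in> bad (\<rho> x)"
      then obtain p where p: "p \<in> words U" "W = wall p" "side (wall p) (\<rho> x) \<noteq> \<sigma> (wall p)" by (auto simp: bad_def)
      from sh[OF p(1) x p(3)] obtain q e where q: "q \<in> wall p" "e \<in> words U" "length e \<le> n" "equ (\<rho> x @ e) q"
        by (auto simp: near_def)
      then have "\<rho> x @ e \<in> wall p" using wall_eqv by blast
      from wall_eq[OF this] p q show "W \<in> (\<lambda>e. wall (\<rho> x @ e)) ` {e. set e \<subseteq> U \<times> UNIV \<and> length e \<le> n}"
        by (auto intro!: image_eqI[of _ _ e] simp: in_lists_conv_set)
    qed
    moreover have "finite {e. set e \<subseteq> U \<times> (UNIV :: bool set) \<and> length e \<le> n}"
      by (rule finite_lists_length_le) (use finU in auto)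
    ultimately have "finite (bad (\<rho> x))" using finite_subset by blast
    with \<rho>_words[OF x] show ?thesis by blast
  qed
  then obtain c0 where c0: "c0 \<in> words U \<and> finite (bad c0)" by blast
  from ex_has_least_nat[of "\<lambda>c. c \<in> words U \<and> finite (bad c)", OF c0, of "\<lambda>c. card (bad c)"]
  obtain c where c: "c \<in> words U" "finite (bad c)"
    and c_min: "\<And>c'. c' \<in> words U \<Longrightarrow> finite (bad c') \<Longrightarrow> card (bad c) \<le> card (bad c')"
    by blast
  have "\<exists>u\<in>words (U - {v}). near_U (n + 1) (\<rho> x) (c @ u)" if x: "x \<in> M" for x
  proof -
    have "equ (c @ inverse_word c @ \<rho> x) (\<rho> x)"
      using pe_append_right[OF pe_inverse_right[OF c(1)] \<rho>_words[OF x]] by simp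
    then have u0: "inverse_word c @ \<rho> x \<in> words U \<and> equ (c @ inverse_word c @ \<rho> x) (\<rho> x)"
      using c \<rho>_words[OF x] by simp
    from ex_has_least_nat[of "\<lambda>u. u \<in> words U \<and> equ (c @ u) (\<rho> x)", OF u0, of vcount]
    obtain u where u: "u \<in> words U" "equ (c @ u) (\<rho> x)"
      and u_min: "\<And>u'. u' \<in> words U \<Longrightarrow> equ (c @ u') (\<rho> x) \<Longrightarrow> vcount u \<le> vcount u'"
      by blast
    show ?thesis
    proof (cases "vcount u = 0")
      case True
      then have "u \<in> words (U - {v})" using words_without_v u by blast
      moreover have "near_U (n + 1) (\<rho> x) (c @ u)"
        using near_mono[OF near_0[OF presentation_eq.sym[OF u(2)]]] by simp
      ultimately show ?thesis by blast
    next
      case False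
      then have "\<exists>s\<in>set u. fst s = v" by (simp add: vcount_0_iff)
      from split_list_first_prop[OF this] obtain a s b where
        split: "u = a @ s # b" "fst s = v" "\<forall>t\<in>set a. fst t \<noteq> v" by blast
      have a0: "vcount a = 0" using split by (simp add: vcount_0_iff)
      have aU: "a \<in> words U" "s \<in> U \<times> UNIV" using u split by auto
      let ?p = "edge_base (c @ a) s"
      let ?W = "wall ?p"
      have pU: "?p \<in> words U" using c aU by (auto simp: edge_base_def)
      have cross: "crosses v ?W c u"
        unfolding split(1) by (rule first_wall_crossed[of _ _ _ _ "\<rho> x"]) (use split u u_min a0 in auto)
      have flip: "side W (c @ a @ [s]) \<noteq> side W c \<longleftrightarrow> W = ?W" if "W \<in> wall ` words U" for W
        using that crossing_one_edge[OF c(1) aU(1) a0 split(2)] by (auto simp: side_append)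
      have "?W \<notin> bad c"
      proof
        assume W: "?W \<in> bad c"
        have "W' \<in> bad (c @ a @ [s]) \<longleftrightarrow> W' \<in> bad c - {?W}" for W'
        proof (cases "W' = ?W")
          case True
          then show ?thesis using W flip[of ?W] unfolding bad_def by auto
        next
          case False
          then show ?thesis using flip[of W'] unfolding bad_def by auto
        qed
        then have "bad (c @ a @ [s]) = bad c - {?W}" by blast
        moreover have "c @ a @ [s] \<in> words U" using c aU by auto
        ultimately have "card (bad c) \<le> card (bad c - {?W})" using c_min[of "c @ a @ [s]"] c(2) by simp
        with W c(2) show False using card_Diff1_less[OF c(2) W] by simp
      qed
      then have "side ?W c = \<sigma> ?W" using pU by (auto simp: bad_def)
      moreover have "side ?W (\<rho> x) \<noteq> side ?W c"
        using side_cong[OF u(2)] cross side_append by blast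
      ultimately obtain q where q: "q \<in> ?W" "near_U n (\<rho> x) q" using sh[OF pU x] by auto
      \<comment> \<open>The base of the edge \<open>s\<close> is \<open>c @ a\<close> or adjacent to it; the additional \<open>1\<close> in \<open>n + 1\<close> pays for this.\<close>
      have "\<exists>h\<in>words link. near_U 1 q (c @ a @ h)"
      proof (cases "snd s")
        case True
        with q obtain h where "h \<in> words link" "equ (c @ a @ h) q" by (auto simp: edge_base_def wall_def)
        then show ?thesis using near_mono[OF near_0[OF presentation_eq.sym], of U "commutators A" "c @ a @ h" q 1] by auto
      next
        case False
        with split(2) have "s = (v, False)" by (cases s) auto
        then have "q \<in> wall ((c @ a) @ [(v, False)])" using q by (simp add: edge_base_def)
        from near_wall_tip[OF this] obtain h where "h \<in> words link" "equ (q @ [(v, True)]) (c @ a @ h)" by auto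
        then show ?thesis using vU unfolding near_def
          by (intro bexI[of _ h] bexI[of _ "[(v, True)]"]) auto
      qed
      then obtain h where h: "h \<in> words link" "near_U 1 q (c @ a @ h)" by blast
      have "a @ h \<in> words (U - {v})"
        by (rule words_without_v) (use aU link_words[OF h(1)] a0 vcount_link[OF h(1)] in auto)
      with near_trans[OF q(2) h(2)] show ?thesis by blast
    qed
  qed
  with c(1) show ?thesis by blast
qed

text \<open>
  Move each image by a bounded amount into the coset of \<open>c\<close>, then translate by the inverse of \<open>c\<close>.
\<close>

lemma word_embedding_without_v:
  assumes "M \<noteq> {}" "\<not> coarsely_separates M d wall_trace_family"
  shows "\<exists>\<rho>'. word_embedding A (U - {v}) M d \<rho>'"
proof -
  from shallow_sides[OF assms(2)] obtain n where
    n: "\<And>p. p \<in> words U \<Longrightarrow> \<exists>\<sigma>. \<forall>x\<in>M. side (wall p) (\<rho> x) \<noteq> \<sigma> \<longrightarrow> (\<exists>q\<in>wall p. near_U n (\<rho> x) q)" by blast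
  define \<sigma> where "\<sigma> W = (SOME t. \<forall>x\<in>M. side W (\<rho> x) \<noteq> t \<longrightarrow> (\<exists>q\<in>W. near_U n (\<rho> x) q))" for W
  have sh: "\<exists>q\<in>wall p. near_U n (\<rho> x) q"
    if "p \<in> words U" "x \<in> M" "side (wall p) (\<rho> x) \<noteq> \<sigma> (wall p)" for p x
    using someI_ex[OF n[OF that(1)]] that(2,3) unfolding \<sigma>_def by blast
  obtain c where c: "c \<in> words U" "\<forall>x\<in>M. \<exists>u\<in>words (U - {v}). near_U (n + 1) (\<rho> x) (c @ u)"
    using near_coset[of \<sigma> n, OF assms(1) sh] by blast
  then obtain u where u: "\<And>x. x \<in> M \<Longrightarrow> u x \<in> words (U - {v})" "\<And>x. x \<in> M \<Longrightarrow> near_U (n + 1) (\<rho> x) (c @ u x)"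
    by metis
  have "near (U - {v}) (commutators A) ((n + 1) + (K + (n + 1))) (u x) (u y)"
    if xy: "x \<in> M" "y \<in> M" "d x y \<le> 1" for x y
  proof (rule near_subset[OF near_left_cancel[OF _ c(1)]])
    show "near_U ((n + 1) + (K + (n + 1))) (c @ u x) (c @ u y)"
      by (rule near_trans[OF near_sym[OF u(2)[OF xy(1)]] near_trans[OF \<rho>_unit[OF xy] u(2)[OF xy(2)]]])
  qed (use u xy in auto)
  moreover have "\<exists>R. \<forall>x\<in>M. \<forall>y\<in>M. near (U - {v}) (commutators A) k (u x) (u y) \<longrightarrow> d x y \<le> R" for k
  proof -
    obtain R where R: "\<And>x y. x \<in> M \<Longrightarrow> y \<in> M \<Longrightarrow> near_U ((n + 1) + (k + (n + 1))) (\<rho> x) (\<rho> y) \<Longrightarrow> d x y \<le> R"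
      using \<rho>_proper by blast
    have "d x y \<le> R" if xy: "x \<in> M" "y \<in> M" "near (U - {v}) (commutators A) k (u x) (u y)" for x y
    proof -
      have "near_U k (u x) (u y)" by (rule near_superset[OF xy(3)]) blast
      then have "near_U k (c @ u x) (c @ u y)" using c(1) unfolding near_def by (auto intro: pe_append_left)
      from near_trans[OF u(2)[OF xy(1)] near_trans[OF this near_sym[OF u(2)[OF xy(2)]]]]
      show ?thesis using R xy by blast
    qed
    then show ?thesis by blast
  qed
  ultimately show ?thesis unfolding word_embedding_def using u(1) by blast
qed

end

text \<open>
  Remove simplicial generators one at a time. In the end the group is trivial, and then \<open>M\<close>
  is bounded, hence finite because balls are.
\<close>

lemma (in bounded_graph_metric) no_word_embedding:
  assumes "commutation A" "infinite M" "finite U"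
    and simplicial: "\<And>W. W \<subseteq> U \<Longrightarrow> W \<noteq> {} \<Longrightarrow> \<exists>v\<in>W. simplicial A W v"
    and cliques: "\<And>Q. Q \<subseteq> U \<Longrightarrow> (\<forall>a\<in>Q. \<forall>b\<in>Q. a \<noteq> b \<longrightarrow> (a, b) \<in> A) \<Longrightarrow> card Q \<le> c"
    and nsep: "\<And>\<S>. coarsely_separates M d \<S> \<Longrightarrow> \<not> growth_bigo (growth M d \<S>) (\<lambda>r. r ^ c)"
  shows "\<not> word_embedding A U M d \<rho>"
  using assms(3) simplicial cliques
proof (induction "card U" arbitrary: U \<rho>)
  case 0
  then have U: "U = {}" by simp
  show ?case
  proof
    assume emb: "word_embedding A U M d \<rho>"
    then obtain R where R: "\<And>x y. x \<in> M \<Longrightarrow> y \<in> M \<Longrightarrow> near U (commutators A) 0 (\<rho> x) (\<rho> y) \<Longrightarrow> d x y \<le> R"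
      unfolding word_embedding_def by blast
    have "\<rho> x = []" if "x \<in> M" for x using emb that U by (auto simp: word_embedding_def)
    then have "d x y \<le> R" if "x \<in> M" "y \<in> M" for x y
      using R[OF that] that by (auto intro: near_0 presentation_eq.refl)
    then have "M \<subseteq> {y\<in>M. d x y \<le> R}" if "x \<in> M" for x using that by blast
    moreover obtain x where "x \<in> M" using assms(2) by fastforce
    ultimately show False using balls_bounded[of R] assms(2) finite_subset by blast
  qed
next
  case (Suc n)
  then have "U \<noteq> {}" by auto
  from Suc.prems(2)[OF order_refl this] obtain v where v: "v \<in> U"
    and vs: "simplicial A U v" ..
  show ?case
  proof
    assume emb: "word_embedding A U M d \<rho>"
    then obtain K where K: "\<And>x y. x \<in> M \<Longrightarrow> y \<in> M \<Longrightarrow> d x y \<le> 1 \<Longrightarrow> near U (commutators A) K (\<rho> x) (\<rho> y)"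
      unfolding word_embedding_def by blast
    interpret commutation A by fact
    interpret pivot A U v by unfold_locales (use Suc.prems v in auto)
    interpret wall_traces M d A U v \<rho> K
      by unfold_locales (use vs K emb in \<open>auto simp: link_def simplicial_def word_embedding_def\<close>)
    have "card link \<le> c" by (rule Suc.prems(3)[OF link_subset]) (use link_clique in auto)
    then have "\<not> coarsely_separates M d wall_trace_family" using nsep wall_trace_family_growth by blast
    moreover have "M \<noteq> {}" using assms(2) by auto
    ultimately obtain \<rho>' where "word_embedding A (U - {v}) M d \<rho>'" using word_embedding_without_v by blast
    moreover have "\<not> word_embedding A (U - {v}) M d \<rho>'"
      by (rule Suc.hyps(1)) (use Suc.hyps(2) Suc.prems v in \<open>auto simp: subset_iff\<close>)
    ultimately show False by blast
  qed
qed

section \<open>Word metrics and representing words\<close>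

locale generated_presentation =
  fixes V :: "'v set" and R :: "('v \<times> bool) list set" and T :: "('v \<times> bool) list set set"
  assumes finV: "finite V" and finT: "finite T"
    and T_sub: "T \<subseteq> carrier (presented_group V R)"
    and T_gen: "generate (presented_group V R) T = carrier (presented_group V R)"
begin

abbreviation G where "G \<equiv> presented_group V R"
abbreviation cl where "cl w \<equiv> presentation_rel V R `` {w}"

sublocale group "presented_group V R" by (rule group_presented_group)

lemma cl_carrier: "w \<in> words V \<Longrightarrow> cl w \<in> carrier G"
  by (simp add: presented_group_def quotientI)

lemma carrier_cl: "g \<in> carrier G \<Longrightarrow> \<exists>w\<in>words V. g = cl w"
  by (auto simp: presented_group_def elim: quotientE)

lemma cl_eq_iff: "u \<in> words V \<Longrightarrow> w \<in> words V \<Longrightarrow> cl u = cl w \<longleftrightarrow> presentation_eq V R u w"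
  using eq_equiv_class_iff[OF equiv_presentation_rel, of u V w R] by (simp add: presentation_rel_def)

lemma difference_eq_iff:
  assumes "a \<in> words V" "b \<in> words V" "e \<in> words V"
  shows "inv\<^bsub>G\<^esub> (cl a) \<otimes>\<^bsub>G\<^esub> cl b = cl e \<longleftrightarrow> presentation_eq V R (a @ e) b"
proof -
  have "inv\<^bsub>G\<^esub> (cl a) \<otimes>\<^bsub>G\<^esub> cl b = cl e \<longleftrightarrow> cl b = cl a \<otimes>\<^bsub>G\<^esub> cl e"
    using inv_solve_left[of "cl e" "cl a" "cl b"] assms cl_carrier by auto
  also have "\<dots> \<longleftrightarrow> cl (a @ e) = cl b" using presented_mult[of a V e R] assms by auto
  finally show ?thesis using cl_eq_iff[of "a @ e" b] assms by simp
qed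

abbreviation prod_word where "prod_word ws \<equiv> foldr (mult G) ws \<one>\<^bsub>G\<^esub>"

lemma prod_word_append:
  "set us \<subseteq> carrier G \<Longrightarrow> set ws \<subseteq> carrier G \<Longrightarrow>
    prod_word us \<in> carrier G \<and> prod_word (us @ ws) = prod_word us \<otimes>\<^bsub>G\<^esub> prod_word ws"
proof (induction us)
  case Nil
  have "prod_word ws \<in> carrier G" using Nil(2) by (induction ws) auto
  then show ?case by simp
next
  case (Cons a us)
  have "prod_word ws \<in> carrier G" using Cons(3) by (induction ws) auto
  with Cons show ?case by (simp add: m_assoc)
qed

lemma letters_carrier: "T \<union> m_inv G ` T \<subseteq> carrier G"
  using T_sub by auto

lemma ex_prod_word:
  assumes "g \<in> carrier G"
  shows "\<exists>ws. set ws \<subseteq> T \<union> m_inv G ` T \<and> prod_word ws = g"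
proof -
  have "g \<in> generate G T" using assms T_gen by simp
  then show ?thesis
  proof (induction rule: generate.induct)
    case one
    show ?case by (intro exI[of _ "[]"]) auto
  next
    case (incl h)
    then show ?case using T_sub by (intro exI[of _ "[h]"]) auto
  next
    case (inv h)
    then show ?case using T_sub by (intro exI[of _ "[inv\<^bsub>G\<^esub> h]"]) auto
  next
    case (eng h1 h2)
    then obtain us ws where us: "set us \<subseteq> T \<union> m_inv G ` T" "prod_word us = h1"
      and ws: "set ws \<subseteq> T \<union> m_inv G ` T" "prod_word ws = h2" by blast
    have "set us \<subseteq> carrier G" "set ws \<subseteq> carrier G"
      by (rule subset_trans[OF us(1) letters_carrier] subset_trans[OF ws(1) letters_carrier])+
    from prod_word_append[OF this] have "prod_word (us @ ws) = h1 \<otimes>\<^bsub>G\<^esub> h2"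
      unfolding us(2) ws(2) by (rule conjunct2)
    moreover have "set (us @ ws) \<subseteq> T \<union> m_inv G ` T" using us(1) ws(1) by simp
    ultimately show ?case by (intro exI[of _ "us @ ws"] conjI)
  qed
qed

lemma word_length_attained:
  assumes "g \<in> carrier G"
  shows "\<exists>ws. length ws = word_length G T g \<and> set ws \<subseteq> T \<union> m_inv G ` T \<and> prod_word ws = g"
proof -
  obtain us where us: "set us \<subseteq> T \<union> m_inv G ` T" "prod_word us = g" using ex_prod_word[OF assms] by blast
  show ?thesis unfolding word_length_def
    by (rule LeastI[of _ "length us"]) (use us in blast)
qed

lemma finite_word_balls: "finite {g \<in> carrier G. word_length G T g \<le> n}"
proof (rule finite_subset)
  show "{g \<in> carrier G. word_length G T g \<le> n}
      \<subseteq> prod_word ` {ws. set ws \<subseteq> T \<union> m_inv G ` T \<and> length ws \<le> n}"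
    using word_length_attained by fastforce
  show "finite (prod_word ` {ws. set ws \<subseteq> T \<union> m_inv G ` T \<and> length ws \<le> n})"
    by (intro finite_imageI finite_lists_length_le) (use finT in auto)
qed

text \<open>
  Balls of the word metric are finite, so finitely many representing words account for all elements
  of bounded length. This and the next lemma compare \<open>T\<close> with the generators of the presentation.
\<close>

lemma near_if_word_dist_le:
  "\<exists>K. \<forall>a\<in>words V. \<forall>b\<in>words V. word_dist G T (cl a) (cl b) \<le> real n \<longrightarrow> near V R K a b"
proof -
  obtain rep where rep: "\<And>g. g \<in> carrier G \<Longrightarrow> rep g \<in> words V \<and> g = cl (rep g)"
    using carrier_cl by metis
  let ?B = "{g \<in> carrier G. word_length G T g \<le> n}"
  define K where "K = (\<Sum>g\<in>?B. length (rep g))"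
  have "near V R K a b" if ab: "a \<in> words V" "b \<in> words V" "word_dist G T (cl a) (cl b) \<le> real n" for a b
  proof -
    let ?g = "inv\<^bsub>G\<^esub> (cl a) \<otimes>\<^bsub>G\<^esub> cl b"
    have g: "?g \<in> carrier G" using cl_carrier ab by simp
    then have "?g \<in> ?B" using ab(3) by (simp add: word_dist_def)
    then have "length (rep ?g) \<le> K" unfolding K_def by (intro member_le_sum finite_word_balls) auto
    moreover have "presentation_eq V R (a @ rep ?g) b"
      using difference_eq_iff[OF ab(1,2), of "rep ?g"] rep[OF g] by simp
    ultimately show ?thesis using rep[OF g] by (auto simp: near_def)
  qed
  then show ?thesis by blast
qed

lemma word_dist_le_if_near:
  "\<exists>m. \<forall>a b. near V R n a b \<longrightarrow> word_dist G T (cl a) (cl b) \<le> real m"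
proof -
  let ?E = "{e. set e \<subseteq> V \<times> (UNIV :: bool set) \<and> length e \<le> n}"
  have fin: "finite ?E" by (rule finite_lists_length_le) (use finV in auto)
  define m where "m = (\<Sum>e\<in>?E. word_length G T (cl e))"
  have "word_dist G T (cl a) (cl b) \<le> real m" if ab: "near V R n a b" for a b
  proof -
    obtain e where e: "e \<in> words V" "length e \<le> n" "presentation_eq V R (a @ e) b"
      using ab by (auto simp: near_def)
    have W: "a \<in> words V" "b \<in> words V" using presentation_eq_words[OF e(3)] by auto
    have "e \<in> ?E" using e by (auto simp: in_lists_conv_set)
    then have "word_length G T (cl e) \<le> m" unfolding m_def by (intro member_le_sum fin) auto
    moreover have "inv\<^bsub>G\<^esub> (cl a) \<otimes>\<^bsub>G\<^esub> cl b = cl e" using difference_eq_iff[OF W e(1)] e(3) by simp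
    ultimately show ?thesis by (simp add: word_dist_def)
  qed
  then show ?thesis by blast
qed

end

lemma word_embedding_if_coarse_embedding:
  assumes gen: "generated_presentation V (commutators A) T"
    and emb: "coarse_embedding M d (carrier (presented_group V (commutators A)))
               (word_dist (presented_group V (commutators A)) T) \<rho>"
    and nonneg: "\<And>x y. x \<in> M \<Longrightarrow> y \<in> M \<Longrightarrow> 0 \<le> d x y"
  shows "\<exists>u. word_embedding A V M d u"
proof -
  interpret generated_presentation V "commutators A" T by fact
  let ?D = "word_dist G T"
  from emb have into: "\<rho> ` M \<subseteq> carrier G" by (simp add: coarse_embedding_def)
  from emb obtain \<rho>1 \<rho>2 :: "real \<Rightarrow> real" where
    mono2: "mono_on {0..} \<rho>2" and inf1: "filterlim \<rho>1 at_top at_top"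
    and bounds: "\<forall>x\<in>M. \<forall>y\<in>M. \<rho>1 (d x y) \<le> ?D (\<rho> x) (\<rho> y) \<and> ?D (\<rho> x) (\<rho> y) \<le> \<rho>2 (d x y)"
    unfolding coarse_embedding_def by (elim conjE exE) (rule that, assumption+)
  have "\<forall>x\<in>M. \<exists>w\<in>words V. \<rho> x = cl w" using carrier_cl into by blast
  then obtain u where u: "\<And>x. x \<in> M \<Longrightarrow> u x \<in> words V" "\<And>x. x \<in> M \<Longrightarrow> \<rho> x = cl (u x)" by metis
  define n where "n = nat \<lceil>\<rho>2 1\<rceil>"
  obtain K where K: "\<And>a b. a \<in> words V \<Longrightarrow> b \<in> words V \<Longrightarrow> ?D (cl a) (cl b) \<le> real n \<Longrightarrow> near V (commutators A) K a b"
    using near_if_word_dist_le by blast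
  have "near V (commutators A) K (u x) (u y)" if xy: "x \<in> M" "y \<in> M" "d x y \<le> 1" for x y
  proof (rule K)
    have "?D (\<rho> x) (\<rho> y) \<le> \<rho>2 (d x y)" using bounds xy by blast
    also have "\<dots> \<le> \<rho>2 1" using mono2 nonneg xy by (intro mono_onD[OF mono2]) auto
    also have "\<dots> \<le> real n" unfolding n_def by linarith
    finally show "?D (cl (u x)) (cl (u y)) \<le> real n" using u xy by simp
  qed (use u xy in auto)
  moreover have "\<exists>R. \<forall>x\<in>M. \<forall>y\<in>M. near V (commutators A) k (u x) (u y) \<longrightarrow> d x y \<le> R" for k
  proof -
    obtain m where m: "\<And>a b. near V (commutators A) k a b \<Longrightarrow> ?D (cl a) (cl b) \<le> real m"
      using word_dist_le_if_near by blast
    have "\<forall>\<^sub>F t in at_top. \<rho>1 t > real m" using inf1 by (simp add: filterlim_at_top_dense)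
    then obtain R where R: "\<And>t. t \<ge> R \<Longrightarrow> \<rho>1 t > real m" by (auto simp: eventually_at_top_linorder)
    have "d x y \<le> R" if xy: "x \<in> M" "y \<in> M" "near V (commutators A) k (u x) (u y)" for x y
    proof (rule ccontr)
      assume "\<not> d x y \<le> R"
      then have "\<rho>1 (d x y) > real m" using R by simp
      moreover have "\<rho>1 (d x y) \<le> ?D (cl (u x)) (cl (u y))" using bounds[rule_format, OF xy(1,2)] u xy by simp
      ultimately show False using m[OF xy(3)] by simp
    qed
    then show ?thesis by blast
  qed
  ultimately show ?thesis unfolding word_embedding_def using u(1) by blast
qed

lemma clique_card_le_clique_number:
  assumes "finite (pverts G)" "Q \<subseteq> pverts G" "\<forall>a\<in>Q. \<forall>b\<in>Q. a \<noteq> b \<longrightarrow> (a, b) \<in> parcs G"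
  shows "card Q \<le> clique_number G"
proof -
  let ?S = "{card K |K. K \<subseteq> pverts G \<and> (\<forall>u\<in>K. \<forall>v\<in>K. u \<noteq> v \<longrightarrow> (u, v) \<in> parcs G)}"
  have "?S \<subseteq> card ` Pow (pverts G)" by auto
  then have "finite ?S" using assms(1) finite_subset by blast
  then show ?thesis unfolding clique_number_def using assms(2,3) by (intro Max_ge) auto
qed

theorem corollary1p16:
  fixes \<Gamma> :: "'v pair_pre_digraph"
    and X :: "'x pair_pre_digraph"
    and T :: "('v \<times> bool) list set set"
  assumes "pair_graph \<Gamma>" and "chordal \<Gamma>"
    and "bounded_degree_graph X" and "infinite (pverts X)"
    and "finite T" and "T \<subseteq> carrier (raag \<Gamma>)" and "generate (raag \<Gamma>) T = carrier (raag \<Gamma>)"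
  shows
    "(\<not> (\<exists>\<S>. coarsely_separates (pverts X) (graph_dist X) \<S> \<and>
             growth_bigo (growth (pverts X) (graph_dist X) \<S>) (\<lambda>r. r ^ clique_number \<Gamma>))
      \<longrightarrow> \<not> (\<exists>\<rho>. coarse_embedding (pverts X) (graph_dist X)
                    (carrier (raag \<Gamma>)) (word_dist (raag \<Gamma>) T) \<rho>))
     \<and>
     (\<forall>d. d > real (clique_number \<Gamma>) \<and> class_M d (pverts X) (graph_dist X)
      \<longrightarrow> \<not> (\<exists>\<S>. coarsely_separates (pverts X) (graph_dist X) \<S> \<and>
             growth_bigo (growth (pverts X) (graph_dist X) \<S>) (\<lambda>r. r ^ clique_number \<Gamma>)))"
proof (intro conjI impI allI)
  interpret \<Gamma>: pair_graph \<Gamma> by fact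
  interpret X: bounded_graph_metric "pverts X" "graph_dist X"
    by (rule bounded_graph_metric_graph_dist) fact
  have raag: "raag \<Gamma> = presented_group (pverts \<Gamma>) (commutators (parcs \<Gamma>))"
    by (simp add: raag_def commutators_def)
  have fin: "finite (pverts \<Gamma>)" by simp
  have com: "commutation (parcs \<Gamma>)"
  proof
    show "(b, a) \<in> parcs \<Gamma>" if "(a, b) \<in> parcs \<Gamma>" for a b
      using \<Gamma>.pair_sym_arcs that by (auto simp: symmetric_def sym_def)
    show "(a, a) \<notin> parcs \<Gamma>" for a using \<Gamma>.no_loops' by blast
  qed
  interpret commutation "parcs \<Gamma>" by (fact com)
  assume nsep: "\<not> (\<exists>\<S>. coarsely_separates (pverts X) (graph_dist X) \<S> \<and>
             growth_bigo (growth (pverts X) (graph_dist X) \<S>) (\<lambda>r. r ^ clique_number \<Gamma>))"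
  show "\<not> (\<exists>\<rho>. coarse_embedding (pverts X) (graph_dist X)
                    (carrier (raag \<Gamma>)) (word_dist (raag \<Gamma>) T) \<rho>)"
  proof
    assume "\<exists>\<rho>. coarse_embedding (pverts X) (graph_dist X)
                    (carrier (raag \<Gamma>)) (word_dist (raag \<Gamma>) T) \<rho>"
    then obtain \<rho> where emb: "coarse_embedding (pverts X) (graph_dist X)
                    (carrier (raag \<Gamma>)) (word_dist (raag \<Gamma>) T) \<rho>" ..
    have "generated_presentation (pverts \<Gamma>) (commutators (parcs \<Gamma>)) T"
      by unfold_locales (use assms(5-7) fin in \<open>simp_all add: raag\<close>)
    from word_embedding_if_coarse_embedding[OF this emb[unfolded raag]] X.nonneg
    obtain u where u: "word_embedding (parcs \<Gamma>) (pverts \<Gamma>) (pverts X) (graph_dist X) u" by blast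
    have "\<not> word_embedding (parcs \<Gamma>) (pverts \<Gamma>) (pverts X) (graph_dist X) u"
    proof (rule X.no_word_embedding[OF com assms(4) fin])
      fix W assume W: "W \<subseteq> pverts \<Gamma>" "W \<noteq> {}"
      show "\<exists>v\<in>W. simplicial (parcs \<Gamma>) W v"
        by (rule simplicial_vertex_exists[OF symA irreflA finite_subset[OF W(1) fin]
              hole_free_if_chordal[OF assms(2) W(1)] W(2)])
    next
      show "card Q \<le> clique_number \<Gamma>"
        if "Q \<subseteq> pverts \<Gamma>" "\<forall>a\<in>Q. \<forall>b\<in>Q. a \<noteq> b \<longrightarrow> (a, b) \<in> parcs \<Gamma>" for Q
        using clique_card_le_clique_number[OF fin that] .
    qed (use nsep in blast)
    with u show False by blast
  qed
next
  fix d
  assume d: "d > real (clique_number \<Gamma>) \<and> class_M d (pverts X) (graph_dist X)"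
  show "\<not> (\<exists>\<S>. coarsely_separates (pverts X) (graph_dist X) \<S> \<and>
             growth_bigo (growth (pverts X) (graph_dist X) \<S>) (\<lambda>r. r ^ clique_number \<Gamma>))"
  proof
    assume "\<exists>\<S>. coarsely_separates (pverts X) (graph_dist X) \<S> \<and>
             growth_bigo (growth (pverts X) (graph_dist X) \<S>) (\<lambda>r. r ^ clique_number \<Gamma>)"
    then obtain \<S> where "coarsely_separates (pverts X) (graph_dist X) \<S> \<and>
             growth_bigo (growth (pverts X) (graph_dist X) \<S>) (\<lambda>r. r ^ clique_number \<Gamma>)" ..
    with d show False using class_M_not_separated[OF assms(3)] by metis
  qed
qed

end
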